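(* Let $\varphi$ be a strongly convex function satisfying the $\tilde\nabla$-condition, let $\gamma$ be a $\tilde\nabla$-admissible function for $\varphi$, and put $\Phi=\varphi\circ\log$. Then $$\operatorname{Mult}(\mathcal H_\Phi)\subset\bigcap_{n\ge 1}\mathcal H_{\Psi_\gamma^{[n]}},\qquad\text{where } \Psi_\gamma^{[n]}(t)=\varphi\big(\gamma^{-1}(n\log t)\big).$$
   Context: $\mathbb D$ is the open unit disk, $\mathbb T=\partial\mathbb D$ with normalized Lebesgue measure $m$, $\operatorname{Hol}(\mathbb D)$ is the space of holomorphic functions on $\mathbb D$, and $N^+$ is the Smirnov class on $\mathbb D$; functions in $N^+$ have non-tangential boundary values a.e. on $\mathbb T$, denoted by the same letter. A function $\varphi:\mathbb R\to[0,\infty)$ is strongly convex if it is convex, nondecreasing and $\lim_{t\to\infty}\varphi(t)/t=\infty$; one sets $\varphi(-\infty)=0$. For a nondecreasing $\Phi:[0,\infty)\to[0,\infty)$, the Hardy-Orlicz class is $\mathcal H_\Phi=\{f\in N^+:\int_{\mathbb T}\Phi(|f|)\,dm<\infty\}$. For $X\subset\operatorname{Hol}(\mathbb D)$, $\operatorname{Mult}(X)=\{g\in\operatorname{Hol}(\mathbb D): gf\in X \text{ for all } f\in X\}$. A convex, strictly increasing $\varphi:\mathbb R\to\mathbb R^+$ with $\varphi(t)/t\to\infty$ as $t\to\infty$ satisfies the $\tilde\nabla$-condition if there are a strictly increasing concave function $\gamma:\mathbb R^+\to\mathbb R^+$ with $\lim_{s\to\infty}\gamma(s)=\infty$, an $\varepsilon>0$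 and a threshold $s_\gamma$ such that $\varphi(s+\gamma(s))/\varphi(s)\ge(\log\varphi(s))^{1+\varepsilon}$ for all $s\ge s_\gamma$. Any such $\gamma$ (for suitable $s_\gamma$ and $\varepsilon>0$) is called $\tilde\nabla$-admissible for $\varphi$. Convention: $\gamma^{-1}(u):=0$ for $u\le \inf_{s>0}\gamma(s)$ (including $u=-\infty$); the values of $\Psi_\gamma^{[n]}(t)$ for small $t$ do not affect the class $\mathcal H_{\Psi_\gamma^{[n]}}$. *)

theory Defs
  imports "HOL-Complex_Analysis.Complex_Analysis"
begin

definition circle_measure :: "complex measure" where
  "circle_measure = distr (uniform_measure lborel {0..2*pi}) borel cis"

definition Hol_disk :: "(complex \<Rightarrow> complex) set" where
  "Hol_disk = {f. f holomorphic_on ball 0 1}"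

definition stolz_region :: "complex \<Rightarrow> real \<Rightarrow> complex set" where
  "stolz_region \<zeta> \<alpha> = {z \<in> ball 0 1. dist z \<zeta> < \<alpha> * (1 - norm z)}"

definition has_nontangential_limit :: "(complex \<Rightarrow> complex) \<Rightarrow> complex \<Rightarrow> complex \<Rightarrow> bool" where
  "has_nontangential_limit f \<zeta> L \<longleftrightarrow>
     (\<forall>\<alpha>>1. (f \<longlongrightarrow> L) (at \<zeta> within stolz_region \<zeta> \<alpha>))"

(* Unspecified where no non-tangential limit exists, for functions in the Smirnov class
   a null set. *)
definition boundary_value :: "(complex \<Rightarrow> complex) \<Rightarrow> complex \<Rightarrow> complex" where
  "boundary_value f \<zeta> = (THE L. has_nontangential_limit f \<zeta> L)"

(* u is the logarithm of the modulus of the boundary values of h. *)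
definition outer_function :: "(complex \<Rightarrow> complex) \<Rightarrow> bool" where
  "outer_function h \<longleftrightarrow>
     (\<exists>c u. norm c = 1 \<and> integrable circle_measure (u :: complex \<Rightarrow> real) \<and>
        (\<forall>z \<in> ball 0 1. h z = c * exp (LINT \<zeta>|circle_measure.
            (\<zeta> + z) / (\<zeta> - z) * complex_of_real (u \<zeta>))))"

(* The Smirnov class: quotients of bounded holomorphic functions with outer denominator. *)
definition Smirnov :: "(complex \<Rightarrow> complex) set" where
  "Smirnov = {f \<in> Hol_disk. \<exists>g h.
     g \<in> Hol_disk \<and> bounded (g ` ball 0 1) \<and>
     h \<in> Hol_disk \<and> bounded (h ` ball 0 1) \<and> outer_function h \<and>
     (\<forall>z \<in> ball 0 1. f z = g z / h z)}"

definition Hardy_Orlicz :: "(real \<Rightarrow> real) \<Rightarrow> (complex \<Rightarrow> complex) set" where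
  "Hardy_Orlicz \<Phi> = {f \<in> Smirnov.
     (\<integral>\<^sup>+\<zeta>. ennreal (\<Phi> (norm (boundary_value f \<zeta>))) \<partial>circle_measure) < \<infinity>}"

definition Mult :: "(complex \<Rightarrow> complex) set \<Rightarrow> (complex \<Rightarrow> complex) set" where
  "Mult X = {g \<in> Hol_disk. \<forall>f \<in> X. (\<lambda>z. g z * f z) \<in> X}"

definition strongly_convex :: "(real \<Rightarrow> real) \<Rightarrow> bool" where
  "strongly_convex \<phi> \<longleftrightarrow>
     (\<forall>t. 0 \<le> \<phi> t) \<and> convex_on UNIV \<phi> \<and> mono \<phi> \<and>
     filterlim (\<lambda>t. \<phi> t / t) at_top at_top"

(* Only the values of \<gamma> on the open half-line matter. Since the threshold is existential,
   taking it positive is no restriction, and neither is the convention for powr at a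
   negative base, because ln (\<phi> s) is eventually positive. *)
definition nabla_admissible :: "(real \<Rightarrow> real) \<Rightarrow> (real \<Rightarrow> real) \<Rightarrow> bool" where
  "nabla_admissible \<phi> \<gamma> \<longleftrightarrow>
     (\<forall>s>0. 0 < \<gamma> s) \<and> strict_mono_on {0<..} \<gamma> \<and> concave_on {0<..} \<gamma> \<and>
     filterlim \<gamma> at_top at_top \<and>
     (\<exists>\<epsilon>>0. \<exists>s\<^sub>0>0. \<forall>s\<ge>s\<^sub>0. \<phi> (s + \<gamma> s) / \<phi> s \<ge> ln (\<phi> s) powr (1 + \<epsilon>))"

definition nabla_condition :: "(real \<Rightarrow> real) \<Rightarrow> bool" where
  "nabla_condition \<phi> \<longleftrightarrow>
     (\<forall>t. 0 < \<phi> t) \<and> convex_on UNIV \<phi> \<and> strict_mono \<phi> \<and>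
     filterlim (\<lambda>t. \<phi> t / t) at_top at_top \<and>
     (\<exists>\<gamma>. nabla_admissible \<phi> \<gamma>)"

(* Logarithm on [0,\<infinity>) with value -\<infinity> at 0; the library has ln 0 = 0. *)
definition log_ext :: "real \<Rightarrow> ereal" where
  "log_ext t = (if t \<le> 0 then -\<infinity> else ereal (ln t))"

(* \<phi> \<circ> log with the convention \<phi>(-\<infinity>) = 0. *)
definition comp_log :: "(real \<Rightarrow> real) \<Rightarrow> real \<Rightarrow> real" where
  "comp_log \<phi> t = (if log_ext t = -\<infinity> then 0 else \<phi> (real_of_ereal (log_ext t)))"

(* Used for u < \<infinity> only. For u above the infimum, the inverse of the bijection
   \<gamma> from (0,\<infinity>) onto (inf \<gamma>,\<infinity>). *)
definition gamma_inverse :: "(real \<Rightarrow> real) \<Rightarrow> ereal \<Rightarrow> real" where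
  "gamma_inverse \<gamma> u =
     (if u \<le> (INF s\<in>{0<..}. ereal (\<gamma> s)) then 0
      else the_inv_into {0<..} \<gamma> (real_of_ereal u))"

definition Psi :: "(real \<Rightarrow> real) \<Rightarrow> (real \<Rightarrow> real) \<Rightarrow> nat \<Rightarrow> real \<Rightarrow> real" where
  "Psi \<phi> \<gamma> n t = \<phi> (gamma_inverse \<gamma> (ereal (real n) * log_ext t))"

end

theory Submission
  imports Defs "HOL-Probability.Distribution_Functions" "HOL-Real_Asymp.Real_Asymp"
begin

text \<open>
  Suppose \<open>g\<close> is a multiplier and \<open>F = \<Psi>(|g|)\<close> has infinite integral over the circle. By compactness
  there is a point \<open>\<zeta>0\<close> such that \<open>F\<close> has infinite integral over every neighbourhood of \<open>\<zeta>0\<close>. Since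
  \<open>\<Sum> k powr -(1 + \<epsilon>/2)\<close> converges, arbitrarily close to \<open>\<zeta>0\<close> there are sets \<open>A \<subseteq> {F \<ge> 2 ^ k}\<close>
  whose mass is comparable to \<open>2 ^ -k * k powr -(1 + \<epsilon>/2)\<close>, each contained in an open set \<open>U\<close> of
  comparable mass with negligible frontier. Choose such \<open>A\<^sub>j \<subseteq> U\<^sub>j\<close> with \<open>U\<^sub>j\<close> shrinking to \<open>\<zeta>0\<close> and put
  \<open>\<phi>(u) = \<phi>(0) + \<Sum>j. 2 ^ k\<^sub>j * indicator U\<^sub>j\<close>, which is integrable. As \<open>u\<close> is locally constant almost
  everywhere, the outer function \<open>f\<close> with \<open>ln |f| = u\<close> has boundary values of modulus \<open>exp u\<close> by an
  elementary argument that avoids Fatou's theorem, so \<open>f\<close> lies in the Hardy-Orlicz class. On \<open>A\<^sub>j\<close>,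
  with \<open>\<phi>(a) = 2 ^ k\<^sub>j\<close>, one has \<open>|g ^ n * f| \<ge> exp (a + \<gamma>(a))\<close>, and admissibility makes the integral
  of \<open>\<phi>(ln |g ^ n * f|)\<close> over \<open>A\<^sub>j\<close> at least of order \<open>k\<^sub>j powr (\<epsilon>/2)\<close>. It is therefore unbounded in
  \<open>j\<close>, although \<open>g ^ n * f\<close> must lie in the class.
\<close>

section \<open>Normalized arc length on the circle\<close>

text \<open>Writing the uniform measure as a density on \<open>lborel\<close> lets integrals over
  the circle be computed as integrals over an interval of angles.\<close>

lemma circle_measure_eq:
  "circle_measure = distr (density lborel (\<lambda>t. ennreal (indicator {0..2*pi} t / (2*pi)))) borel cis"
proof -
  have "uniform_measure lborel {0..2*pi} = density lborel (\<lambda>t. ennreal (indicator {0..2*pi} t / (2*pi)))"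
    unfolding uniform_measure_def
    using divide_ennreal[of 1 "2*pi"]
    by (intro density_cong AE_I2) (auto split: split_indicator)
  then show ?thesis
    by (simp add: circle_measure_def)
qed

lemma cis_borel_measurable [measurable]: "cis \<in> borel_measurable borel"
  by (intro borel_measurable_continuous_onI continuous_intros)

lemma sets_circle_measure [simp, measurable_cong]: "sets circle_measure = sets borel"
  by (simp add: circle_measure_def)

lemma space_circle_measure [simp]: "space circle_measure = UNIV"
  by (simp add: circle_measure_def)

lemma prob_space_circle_measure: "prob_space circle_measure"
  unfolding circle_measure_def
  by (intro prob_space.prob_space_distr prob_space_uniform_measure) auto

interpretation circle: prob_space circle_measure
  by (rule prob_space_circle_measure)

lemma AE_circle_measure_norm: "AE \<zeta> in circle_measure. norm \<zeta> = 1"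
  unfolding circle_measure_def by (subst AE_distr_iff) auto

lemma circle_measure_null_countable_preimage:
  assumes [measurable]: "B \<in> sets borel" and "countable (cis -` B)"
  shows "measure circle_measure B = 0"
proof -
  have "{0..2*pi} \<inter> cis -` B \<in> null_sets lborel"
    by (rule null_sets_subset[OF countable_imp_null_set_lborel[OF assms(2)]]) auto
  moreover have "emeasure circle_measure B = emeasure lborel ({0..2*pi} \<inter> cis -` B) / emeasure lborel {0..2*pi}"
    unfolding circle_measure_def
    by (subst emeasure_distr, simp, simp, subst emeasure_uniform_measure)
      (auto simp: measurable_sets_borel[OF cis_borel_measurable])
  ultimately show ?thesis
    by (simp add: measure_def null_setsD1)
qed

text \<open>The cosine takes each value at only countably many angles. As a consequence the real
  part has no atoms, which is what the intermediate value argument for sets of prescribed measure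
  requires.\<close>

lemma circle_measure_Re_eq: "measure circle_measure {\<zeta>. Re \<zeta> = c} = 0"
proof (rule circle_measure_null_countable_preimage)
  show "countable (cis -` {\<zeta>. Re \<zeta> = c})"
  proof (cases "\<exists>t. cos t = c")
    case True
    then obtain s where s: "cos s = c" by blast
    have "cis -` {\<zeta>. Re \<zeta> = c} \<subseteq> (\<lambda>n. s + 2*n*pi) ` \<int> \<union> (\<lambda>n. -s + 2*n*pi) ` \<int>"
      using cos_eq[of _ s] by (auto simp: s)
    then show ?thesis
      by (rule countable_subset) (auto simp: countable_int)
  qed (auto simp: vimage_def)
qed measurable

lemma circle_measure_singleton: "measure circle_measure {\<zeta>} = 0"
proof -
  have "measure circle_measure {\<zeta>} \<le> measure circle_measure {\<zeta>'. Re \<zeta>' = Re \<zeta>}"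
    by (intro circle.finite_measure_mono) auto
  then show ?thesis
    by (simp add: circle_measure_Re_eq measure_le_0_iff)
qed

text \<open>Passes from the Bochner integral to an integral over angles, the form in which contour
  integrals over \<open>circlepath\<close> are available.\<close>

lemma circle_integral_continuous:
  fixes F :: "complex \<Rightarrow> complex"
  assumes [measurable]: "F \<in> borel_measurable borel" and "continuous_on (sphere 0 1) F"
  shows "(LINT \<zeta>|circle_measure. F \<zeta>) = integral {0..2*pi} (\<lambda>t. F (cis t)) / (2*pi)"
proof -
  have c: "continuous_on {0..2*pi} (\<lambda>t. F (cis t))"
    by (rule continuous_on_compose2[OF assms(2)]) (auto intro!: continuous_intros)
  have "(LINT \<zeta>|circle_measure. F \<zeta>) = (LINT t|lborel. (indicator {0..2*pi} t / (2*pi)) *\<^sub>R F (cis t))"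
    unfolding circle_measure_eq by (subst integral_distr) (auto simp: integral_density)
  also have "\<dots> = (LINT t|lborel. (1 / (2*pi)) *\<^sub>R (indicator {0..2*pi} t *\<^sub>R F (cis t)))"
    by simp
  also have "\<dots> = (1 / (2*pi)) *\<^sub>R (LINT t:{0..2*pi}|lborel. F (cis t))"
    unfolding set_lebesgue_integral_def by (rule integral_scaleR_right)
  also have "\<dots> = integral {0..2*pi} (\<lambda>t. F (cis t)) / (2*pi)"
    using set_borel_integral_eq_integral(2)[OF borel_integrable_atLeastAtMost'[OF c]]
    by (simp add: scaleR_conv_of_real)
  finally show ?thesis .
qed

text \<open>Cauchy's formula for the constant 1: on the unit circle du equals i u dt, so the
  numerator \<open>\<zeta>\<close> converts the contour integral into an integral against arc
  length.\<close>

lemma circle_integral_Cauchy: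
  assumes z: "norm z < 1"
  shows "(LINT \<zeta>|circle_measure. \<zeta> / (\<zeta> - z)) = 1"
proof -
  have "((\<lambda>u. 1 / (u - z)) has_contour_integral (2 * of_real pi * \<i> * 1)) (circlepath 0 1)"
    by (rule Cauchy_integral_circlepath_simple) (use z in auto)
  then have "((\<lambda>t. 1 / (cis t - z) * \<i> * cis t) has_integral (2 * pi * \<i>)) {0..2*pi}"
    unfolding circlepath_def by (subst (asm) has_contour_integral_part_circlepath_iff) auto
  \<comment> \<open>The factor -i cancels the i in the derivative of \<open>cis\<close>.\<close>
  from has_integral_mult_right[OF this, of "-\<i>"]
  have "((\<lambda>t. cis t / (cis t - z)) has_integral (2 * pi)) {0..2*pi}"
    by (simp add: field_simps)
  moreover have "(LINT \<zeta>|circle_measure. \<zeta> / (\<zeta> - z)) = integral {0..2*pi} (\<lambda>t. cis t / (cis t - z)) / (2*pi)"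
    by (rule circle_integral_continuous) (use z in \<open>auto intro!: continuous_intros\<close>)
  ultimately show ?thesis
    by (simp add: integral_unique)
qed

section \<open>Sets of prescribed measure near a point of infinite mass\<close>

text \<open>The nonnegative integral is a supremum over simple functions, also for a nonmeasurable \<open>F\<close>. This makes
  it unnecessary to show that boundary values are measurable.\<close>

lemma nn_integral_measurable_minorant:
  "\<exists>h \<in> borel_measurable M. h \<le> F \<and> (\<integral>\<^sup>+x. h x \<partial>M) = (\<integral>\<^sup>+x. F x \<partial>M)"
proof -
  let ?S = "{g. simple_function M g \<and> g \<le> F}"
  have "?S \<noteq> {}"
    by (auto intro!: exI[of _ "\<lambda>_. 0"] simp: le_fun_def)
  \<comment> \<open>The supremum is already reached along a sequence, so countably many simple
    functions suffice and their pointwise supremum stays measurable.\<close>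
  from ennreal_SUP_countable_SUP[OF this, of "integral\<^sup>S M"] obtain f :: "nat \<Rightarrow> ennreal"
    where f: "range f \<subseteq> integral\<^sup>S M ` ?S" "(\<integral>\<^sup>+x. F x \<partial>M) = (SUP n. f n)"
    unfolding nn_integral_def by auto
  have "\<forall>n. \<exists>g\<in>?S. f n = integral\<^sup>S M g"
    using f(1) by blast
  then obtain g where g: "\<And>n. simple_function M (g n)" "\<And>n. g n \<le> F" "\<And>n. f n = integral\<^sup>S M (g n)"
    by (metis (no_types, lifting) mem_Collect_eq)
  note [measurable] = borel_measurable_simple_function[OF g(1)]
  let ?h = "\<lambda>x. SUP n. g n x"
  have le: "?h \<le> F"
    using g(2) by (auto simp: le_fun_def intro!: SUP_least)
  have "f n \<le> (\<integral>\<^sup>+x. ?h x \<partial>M)" for n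
    unfolding g(3) nn_integral_eq_simple_integral[OF g(1), symmetric]
    by (intro nn_integral_mono SUP_upper) auto
  then have "(\<integral>\<^sup>+x. F x \<partial>M) \<le> (\<integral>\<^sup>+x. ?h x \<partial>M)"
    unfolding f(2) by (intro SUP_least)
  moreover have "(\<integral>\<^sup>+x. ?h x \<partial>M) \<le> (\<integral>\<^sup>+x. F x \<partial>M)"
    using le by (intro nn_integral_mono) (auto simp: le_fun_def)
  ultimately show ?thesis
    using le by (intro bexI[of _ ?h]) auto
qed

text \<open>Sweep a vertical line across \<open>A\<close>. The mass of \<open>A\<close> to the left
  of it depends continuously on its position because vertical lines are null, so every intermediate
  value is attained.\<close>

lemma circle_measure_subset_of_measure:
  assumes [measurable]: "A \<in> sets borel" and m: "0 \<le> m" "m \<le> measure circle_measure A"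
  obtains B where "B \<in> sets borel" "B \<subseteq> A" "measure circle_measure B = m"
proof -
  define M where "M = distr (density circle_measure (indicator A)) borel Re"
  have eM: "emeasure M X = emeasure circle_measure (A \<inter> Re -` X)" if [measurable]: "X \<in> sets borel" for X
    unfolding M_def
    by (subst emeasure_distr, simp, simp, subst emeasure_density)
      (auto simp: indicator_inter_arith[symmetric] nn_integral_indicator measurable_sets_borel[OF borel_measurable_Re])
  then have mM: "measure M X = measure circle_measure (A \<inter> Re -` X)" if "X \<in> sets borel" for X
    using that by (simp add: measure_def)
  have "space M = UNIV" "sets M = sets borel"
    by (simp_all add: M_def)
  then interpret M: finite_borel_measure M
    using eM[of UNIV]
    by (intro finite_borel_measure.intro finite_borel_measure_axioms.intro finite_measureI)
      (auto simp: circle.emeasure_eq_measure)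
  have null: "measure M {x} = 0" for x
  proof -
    have "measure M {x} \<le> measure circle_measure {\<zeta>. Re \<zeta> = x}"
      by (subst mM) (auto intro!: circle.finite_measure_mono)
    then show ?thesis
      by (simp add: circle_measure_Re_eq measure_le_0_iff)
  qed
  \<comment> \<open>The two extreme values are treated apart, because the limits of the distribution
    function only help when \<open>m\<close> lies strictly between them.\<close>
  consider "m = 0" | "m = measure circle_measure A" | "0 < m" "m < measure circle_measure A"
    using m by linarith
  then show thesis
  proof cases
    case 1 then show ?thesis by (intro that[of "{}"]) auto
  next
    case 2 then show ?thesis by (intro that[of A]) auto
  next
    case 3
    have "eventually (\<lambda>x. cdf M x < m) at_bot"
      using M.cdf_lim_at_bot 3(1) by (rule order_tendstoD)
    then obtain a where a: "cdf M a < m"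
      by (metis eventually_at_bot_linorder order_refl)
    have "(cdf M \<longlongrightarrow> measure circle_measure A) at_top"
      using M.cdf_lim_at_top mM[of UNIV] by (simp add: M_def)
    then have "eventually (\<lambda>x. m < cdf M x) at_top"
      using 3(2) by (rule order_tendstoD)
    then obtain b where b: "m < cdf M b"
      by (metis eventually_at_top_linorder order_refl)
    have "a \<le> b"
      using a b M.cdf_nondecreasing[of b a] by linarith
    then obtain x where "cdf M x = m"
      using IVT[of "cdf M" a m b] a b null by (auto simp: M.isCont_cdf)
    then have "measure circle_measure (A \<inter> Re -` {..x}) = m"
      by (simp add: cdf_def mM)
    then show ?thesis
      by (intro that[of "A \<inter> Re -` {..x}"]) (auto simp: measurable_sets_borel[OF borel_measurable_Re])
  qed
qed

text \<open>The neighbourhoods \<open>{x. infdist x K < r}\<close> shrink to \<open>K\<close>, and their frontiers are disjoint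
  for different \<open>r\<close>, so only countably many of them carry mass.\<close>

lemma circle_measure_thicken_compact:
  assumes K: "compact K" "K \<subseteq> W" "open W" and pos: "measure circle_measure K > 0"
  obtains U where "open U" "K \<subseteq> U" "U \<subseteq> W" "measure circle_measure (frontier U) = 0"
    "measure circle_measure U \<le> 2 * measure circle_measure K"
proof -
  have ne: "K \<noteq> {}" using pos by auto
  have [measurable]: "(\<lambda>x. infdist x K) \<in> borel_measurable borel"
    by (intro borel_measurable_continuous_onI continuous_intros)
  define V where "V = (\<lambda>n::nat. {x. infdist x K \<le> 1 / Suc n})"
  have "(\<Inter>n. V n) = K"
  proof
    show "(\<Inter>n. V n) \<subseteq> K"
    proof
      fix x assume x: "x \<in> (\<Inter>n. V n)"
      have "infdist x K \<le> 0"
      proof (rule field_le_epsilon)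
        fix e :: real assume "0 < e"
        then obtain n where "1 / Suc n < e"
          using nat_approx_posE by blast
        moreover have "infdist x K \<le> 1 / Suc n"
          using x unfolding V_def by blast
        ultimately show "infdist x K \<le> 0 + e" by linarith
      qed
      then show "x \<in> K"
        using in_closed_iff_infdist_zero[OF compact_imp_closed[OF K(1)] ne] infdist_nonneg[of x K] by simp
    qed
  qed (auto simp: V_def)
  moreover have "(\<lambda>n. measure circle_measure (V n)) \<longlonglongrightarrow> measure circle_measure (\<Inter>n. V n)"
  proof (rule circle.finite_Lim_measure_decseq)
    show "range V \<subseteq> sets circle_measure" by (auto simp: V_def)
    show "decseq V"
    proof (rule decseq_SucI)
      fix n
      have "1 / real (Suc (Suc n)) \<le> 1 / real (Suc n)" by (simp add: field_simps)
      then show "V (Suc n) \<subseteq> V n" unfolding V_def by force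
    qed
  qed
  ultimately have "(\<lambda>n. measure circle_measure (V n)) \<longlonglongrightarrow> measure circle_measure K"
    by simp
  \<comment> \<open>Positivity of the mass of \<open>K\<close> puts the limit strictly below its
    double.\<close>
  then have "eventually (\<lambda>n. measure circle_measure (V n) < 2 * measure circle_measure K) sequentially"
    by (rule order_tendstoD) (use pos in auto)
  then obtain n where n: "measure circle_measure (V n) < 2 * measure circle_measure K"
    by (auto simp: eventually_sequentially)
  obtain e where e: "e > 0" "(\<Union>x\<in>K. ball x e) \<subseteq> W"
    using compact_subset_open_imp_ball_epsilon_subset[OF K(1) K(3) K(2)] .
  define N where "N = distr circle_measure borel (\<lambda>x. infdist x K)"
  interpret N: prob_space N
    unfolding N_def by (intro circle.prob_space_distr) simp
  \<comment> \<open>A radius below \<open>e\<close> keeps \<open>U\<close> inside \<open>W\<close>,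
    and one below \<open>1 / Suc n\<close> keeps it inside \<open>V n\<close>, whose mass is already
    controlled.\<close>
  define d where "d = min e (1 / Suc n)"
  have "d > 0" using e by (simp add: d_def)
  then have "uncountable {0<..<d}"
    by (simp add: uncountable_open_interval)
  then have "\<not> {0<..<d} \<subseteq> {r. measure N {r} \<noteq> 0}"
    using N.countable_support countable_subset by blast
  then obtain r where r: "0 < r" "r < d" "measure N {r} = 0"
    by auto
  define U where "U = {x. infdist x K < r}"
  have op: "open U"
    unfolding U_def by (intro open_Collect_less continuous_intros)
  have "closed {x. infdist x K \<le> r}"
    by (intro closed_Collect_le continuous_intros)
  then have "closure U \<subseteq> {x. infdist x K \<le> r}"
    by (intro closure_minimal) (auto simp: U_def)
  then have "frontier U \<subseteq> {x. infdist x K = r}"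
    using op by (auto simp: frontier_def interior_open U_def)
  then have "measure circle_measure (frontier U) \<le> measure circle_measure {x. infdist x K = r}"
    by (intro circle.finite_measure_mono) auto
  also have "\<dots> = measure N {r}"
    unfolding N_def by (subst measure_distr) (auto simp: vimage_def)
  finally have "measure circle_measure (frontier U) = 0"
    using r(3) by (simp add: measure_le_0_iff)
  moreover have "measure circle_measure U \<le> measure circle_measure (V n)"
    using r(2) by (intro circle.finite_measure_mono) (auto simp: U_def V_def d_def)
  moreover have "U \<subseteq> W"
  proof
    fix x assume "x \<in> U"
    then have "infdist x K < e" using r by (auto simp: U_def d_def)
    then obtain y where "y \<in> K" "dist x y < e"
      using infdist_attains_inf[OF compact_imp_closed[OF K(1)] ne, of x] by metis
    then have "x \<in> ball y e" by (simp add: dist_commute)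
    then show "x \<in> W" using e(2) \<open>y \<in> K\<close> by blast
  qed
  moreover have "K \<subseteq> U" using r(1) by (auto simp: U_def)
  ultimately show thesis
    using op n by (intro that[of U]) auto
qed

text \<open>If every level set \<open>L k\<close> with \<open>k \<ge> K\<close> had mass at most
  \<open>2 / (2 ^ k * c k)\<close>, a dyadic layer estimate would bound the integral of
  \<open>h\<close> over \<open>W\<close> by \<open>2 ^ K\<close> plus a multiple of the convergent
  sum of \<open>1 / c k\<close>. So some level set is heavier, and it is then trimmed to the desired
  size.\<close>

lemma circle_measure_hump:
  fixes h :: "complex \<Rightarrow> ennreal" and c :: "nat \<Rightarrow> real"
  assumes h[measurable]: "h \<in> borel_measurable borel" and fin: "\<And>\<zeta>. h \<zeta> < top"
    and W: "open W" and inf: "(\<integral>\<^sup>+\<zeta>. h \<zeta> * indicator W \<zeta> \<partial>circle_measure) = \<infinity>"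
    and c: "\<And>k. c k > 0" "summable (\<lambda>k. 1 / c k)"
  obtains k A U where "k \<ge> K" "A \<in> sets borel" "A \<subseteq> U" "open U" "U \<subseteq> W"
    "measure circle_measure (frontier U) = 0" "\<And>\<zeta>. \<zeta> \<in> A \<Longrightarrow> ennreal (2 ^ k) \<le> h \<zeta>"
    "1 \<le> 2 ^ k * c k * measure circle_measure A" "2 ^ k * c k * measure circle_measure U \<le> 4"
proof -
  have [measurable]: "W \<in> sets borel" using W by simp
  define L where "L = (\<lambda>k::nat. {\<zeta>. ennreal (2 ^ k) \<le> h \<zeta>} \<inter> W)"
  have L[measurable]: "L k \<in> sets borel" for k unfolding L_def by measurable
  have "\<exists>k\<ge>K. 2 < 2 ^ k * c k * measure circle_measure (L k)"
  proof (rule ccontr)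
    assume "\<not> ?thesis"
    then have small: "2 ^ k * c k * measure circle_measure (L k) \<le> 2" if "k \<ge> K" for k
      using that by (meson not_le)
    \<comment> \<open>Where \<open>h\<close> exceeds \<open>2 ^ K\<close>, the single term of the
      dyadic layer containing the value of \<open>h\<close> already dominates it.\<close>
    have pointwise: "h \<zeta> * indicator W \<zeta> \<le> 2 ^ K + (\<Sum>i. ennreal (2 ^ (K+i+1)) * indicator (L (K+i)) \<zeta>)" for \<zeta>
    proof (cases "\<zeta> \<in> W \<and> \<not> h \<zeta> \<le> 2 ^ K")
      case True
      obtain x where x: "h \<zeta> = ennreal x" "x \<ge> 0"
        using fin[of \<zeta>] by (cases "h \<zeta>") auto
      have xK: "2 ^ K < x"
      proof (rule ccontr)
        assume "\<not> 2 ^ K < x"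
        then have "ennreal x \<le> ennreal (2 ^ K)" by (intro ennreal_leI) simp
        also have "\<dots> = 2 ^ K" by (simp flip: ennreal_power)
        finally show False using True x by simp
      qed
      \<comment> \<open>The first power of two above \<open>x\<close>; by minimality the preceding
        power is at most \<open>x\<close>, which places \<open>\<zeta>\<close> in the level set of
        index \<open>n - 1\<close>.\<close>
      define n where "n = (LEAST n. x < 2 ^ n)"
      obtain n0 where "x < 2 ^ n0" using real_arch_pow[of 2 x] by auto
      then have n: "x < 2 ^ n" unfolding n_def by (rule LeastI)
      have "K < n"
      proof (rule ccontr)
        assume "\<not> K < n"
        then have "(2::real) ^ n \<le> 2 ^ K" by (intro power_increasing) auto
        then show False using n xK by linarith
      qed
      then obtain i where i: "n = K + i + 1" using less_imp_add_positive by (metis Suc_eq_plus1 add_Suc_right less_iff_Suc_add)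
      have "\<not> x < 2 ^ (K + i)"
        using not_less_Least[of "K + i" "\<lambda>n. x < 2 ^ n"] i by (auto simp: n_def)
      then have mem: "\<zeta> \<in> L (K + i)"
        using True x by (auto simp: L_def intro!: ennreal_leI)
      have "h \<zeta> * indicator W \<zeta> = ennreal x" using True x by simp
      also have "\<dots> \<le> ennreal (2 ^ (K+i+1)) * indicator (L (K+i)) \<zeta>"
        using mem n i by (simp add: ennreal_leI del: power_Suc)
      also have "\<dots> \<le> (\<Sum>i. ennreal (2 ^ (K+i+1)) * indicator (L (K+i)) \<zeta>)"
      proof -
        have "T i \<le> suminf T" for T :: "nat \<Rightarrow> ennreal"
          using sum_le_suminf[of T "{i}"] by simp
        then show ?thesis .
      qed
      finally show ?thesis by (simp add: add_increasing)
    next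
      case False
      then have "h \<zeta> * indicator W \<zeta> \<le> 2 ^ K" by (auto split: split_indicator)
      then show ?thesis by (simp add: add_increasing2)
    qed
    have "(\<integral>\<^sup>+\<zeta>. h \<zeta> * indicator W \<zeta> \<partial>circle_measure) \<le>
        (\<integral>\<^sup>+\<zeta>. 2 ^ K + (\<Sum>i. ennreal (2 ^ (K+i+1)) * indicator (L (K+i)) \<zeta>) \<partial>circle_measure)"
      by (intro nn_integral_mono pointwise)
    also have "\<dots> = 2 ^ K + (\<Sum>i. ennreal (2 ^ (K+i+1)) * emeasure circle_measure (L (K+i)))"
      by (subst nn_integral_add, simp, simp, subst nn_integral_suminf)
        (auto simp: nn_integral_cmult_indicator circle.emeasure_space_1[simplified])
    also have "\<dots> \<le> 2 ^ K + (\<Sum>i. ennreal (4 * (1 / c (K+i))))"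
    proof (intro add_left_mono suminf_le summableI)
      fix i
      have "2 ^ (K+i+1) * measure circle_measure (L (K+i)) \<le> 4 * (1 / c (K+i))"
        using small[of "K+i"] c(1)[of "K+i"] by (simp add: field_simps)
      then show "ennreal (2 ^ (K+i+1)) * emeasure circle_measure (L (K+i)) \<le> ennreal (4 * (1 / c (K+i)))"
        by (simp add: circle.emeasure_eq_measure ennreal_leI flip: ennreal_mult)
    qed
    also have "\<dots> = 2 ^ K + ennreal (\<Sum>i. 4 * (1 / c (K+i)))"
    proof -
      have "summable (\<lambda>i. 4 * (1 / c (K+i)))"
        using c(2) by (intro summable_mult) (simp add: summable_iff_shift[of "\<lambda>k. 1 / c k" K] add.commute)
      then show ?thesis
        using c(1) by (subst suminf_ennreal2) (auto intro: less_imp_le)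
    qed
    also have "\<dots> < \<infinity>"
      by (simp add: power_less_top_ennreal)
    finally show False using inf by simp
  qed
  then obtain k where k: "k \<ge> K" "2 < 2 ^ k * c k * measure circle_measure (L k)" by blast
  \<comment> \<open>The unit of mass is \<open>1 / q\<close>: \<open>B\<close> has mass exactly
    \<open>2 / q\<close>, a compact part of it keeps more than \<open>1 / q\<close>, and thickening
    at most doubles the mass, whence the constant 4.\<close>
  define q where "q = 2 ^ k * c k"
  have q: "q > 0" using c(1) by (simp add: q_def)
  have "2 / q \<le> measure circle_measure (L k)"
    using k(2)[folded q_def] q by (simp add: field_simps)
  then obtain B where B: "B \<in> sets borel" "B \<subseteq> L k" "measure circle_measure B = 2 / q"
    using circle_measure_subset_of_measure[OF L, of "2 / q" k] q by auto
  have "ennreal (1 / q) < emeasure circle_measure B"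
    using B(3) q by (simp add: circle.emeasure_eq_measure ennreal_less_iff field_simps)
  also have "\<dots> = (SUP A \<in> {A. A \<subseteq> B \<and> compact A}. emeasure circle_measure A)"
    by (intro inner_regular) (use B in \<open>auto simp: circle.emeasure_eq_measure\<close>)
  finally obtain A where A: "A \<subseteq> B" "compact A" "ennreal (1 / q) < emeasure circle_measure A"
    by (auto simp: less_SUP_iff)
  then have mA: "1 / q < measure circle_measure A"
    using q by (simp add: circle.emeasure_eq_measure ennreal_less_iff)
  have "0 < 1 / q" using q by simp
  then have mA0: "0 < measure circle_measure A" using mA by linarith
  have AW: "A \<subseteq> W" using A(1) B(2) by (auto simp: L_def)
  obtain U where U: "open U" "A \<subseteq> U" "U \<subseteq> W" "measure circle_measure (frontier U) = 0"
    "measure circle_measure U \<le> 2 * measure circle_measure A"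
    using circle_measure_thicken_compact[OF A(2) AW W mA0] .
  have "measure circle_measure A \<le> 2 / q"
    using circle.finite_measure_mono[of A B] A(1) B(1,3) by simp
  then have "measure circle_measure U \<le> 4 / q" using U(5) by simp
  moreover have "\<And>\<zeta>. \<zeta> \<in> A \<Longrightarrow> ennreal (2 ^ k) \<le> h \<zeta>"
    using A(1) B(2) by (auto simp: L_def)
  ultimately show thesis
    using k(1) U A mA q
    by (intro that[of k A U, folded q_def]) (auto simp: field_simps compact_imp_closed)
qed

text \<open>If every point had a neighbourhood with finite integral, finitely many of these would
  cover the circle. The point itself can be removed since it is null; this later allows all humps to
  avoid it.\<close>

lemma circle_measure_infinite_point:
  fixes h :: "complex \<Rightarrow> ennreal"
  assumes h[measurable]: "h \<in> borel_measurable borel"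
    and inf: "(\<integral>\<^sup>+\<zeta>. h \<zeta> \<partial>circle_measure) = \<infinity>"
  obtains \<zeta>0 where
    "\<And>W. open W \<Longrightarrow> \<zeta>0 \<in> W \<Longrightarrow> (\<integral>\<^sup>+\<zeta>. h \<zeta> * indicator (W - {\<zeta>0}) \<zeta> \<partial>circle_measure) = \<infinity>"
proof -
  have "\<exists>\<zeta>0. \<forall>W. open W \<longrightarrow> \<zeta>0 \<in> W \<longrightarrow> (\<integral>\<^sup>+\<zeta>. h \<zeta> * indicator W \<zeta> \<partial>circle_measure) = \<infinity>"
  proof (rule ccontr)
    assume "\<not> ?thesis"
    then have "\<forall>z. \<exists>W. open W \<and> z \<in> W \<and> (\<integral>\<^sup>+\<zeta>. h \<zeta> * indicator W \<zeta> \<partial>circle_measure) < \<infinity>"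
      by (metis infinity_ennreal_def less_top)
    then obtain W where W: "\<And>z. open (W z)" "\<And>z. z \<in> W z"
      "\<And>z. (\<integral>\<^sup>+\<zeta>. h \<zeta> * indicator (W z) \<zeta> \<partial>circle_measure) < \<infinity>"
      by metis
    obtain C where C: "C \<subseteq> sphere 0 1" "finite C" "sphere 0 1 \<subseteq> (\<Union>z\<in>C. W z)"
      using compactE_image[of "sphere (0::complex) 1" "sphere 0 1" W] W(1,2) by (metis UN_I compact_sphere subsetI)
    have [measurable]: "W z \<in> sets borel" for z using W(1) by simp
    have "(\<integral>\<^sup>+\<zeta>. h \<zeta> \<partial>circle_measure) \<le> (\<integral>\<^sup>+\<zeta>. (\<Sum>z\<in>C. h \<zeta> * indicator (W z) \<zeta>) \<partial>circle_measure)"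
    proof (rule nn_integral_mono_AE)
      show "AE \<zeta> in circle_measure. h \<zeta> \<le> (\<Sum>z\<in>C. h \<zeta> * indicator (W z) \<zeta>)"
        using AE_circle_measure_norm
      proof eventually_elim
        fix \<zeta> :: complex assume "norm \<zeta> = 1"
        then obtain z where z: "z \<in> C" "\<zeta> \<in> W z" using C(3) by auto
        have "h \<zeta> = h \<zeta> * indicator (W z) \<zeta>" using z by simp
        also have "\<dots> \<le> (\<Sum>z\<in>C. h \<zeta> * indicator (W z) \<zeta>)"
          by (rule member_le_sum) (use z C in auto)
        finally show "h \<zeta> \<le> (\<Sum>z\<in>C. h \<zeta> * indicator (W z) \<zeta>)" .
      qed
    qed
    also have "\<dots> = (\<Sum>z\<in>C. \<integral>\<^sup>+\<zeta>. h \<zeta> * indicator (W z) \<zeta> \<partial>circle_measure)"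
      by (rule nn_integral_sum) simp
    also have "\<dots> < \<infinity>"
      using W(3) C(2) by (simp add: less_top)
    finally show False using inf by simp
  qed
  then obtain z where z: "\<And>W. open W \<Longrightarrow> z \<in> W \<Longrightarrow> (\<integral>\<^sup>+\<zeta>. h \<zeta> * indicator W \<zeta> \<partial>circle_measure) = \<infinity>"
    by blast
  have "AE \<zeta> in circle_measure. \<zeta> \<noteq> z"
    by (rule AE_I[of _ _ "{z}"]) (auto simp: circle.emeasure_eq_measure circle_measure_singleton)
  then have "(\<integral>\<^sup>+\<zeta>. h \<zeta> * indicator (W - {z}) \<zeta> \<partial>circle_measure) = (\<integral>\<^sup>+\<zeta>. h \<zeta> * indicator W \<zeta> \<partial>circle_measure)" for W
    by (intro nn_integral_cong_AE) (auto elim!: eventually_mono split: split_indicator)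
  then show thesis using z that by metis
qed

section \<open>Herglotz integrals and their boundary values\<close>

text \<open>The exponent in \<open>outer_function\<close>; on the disk, its real part is the Poisson
  integral of \<open>u\<close>.\<close>

definition herglotz :: "(complex \<Rightarrow> real) \<Rightarrow> complex \<Rightarrow> complex" where
  "herglotz u z = (LINT \<zeta>|circle_measure. (\<zeta> + z) / (\<zeta> - z) * complex_of_real (u \<zeta>))"

lemma borel_measurable_circle_integrable:
  assumes "integrable circle_measure u"
  shows "u \<in> borel_measurable borel"
  using borel_measurable_integrable[OF assms] by (simp cong: measurable_cong_sets)

text \<open>The kernel is controlled only where \<open>u\<close> is nonzero, so it may be singular
  at a point of the circle near which \<open>u\<close> vanishes.\<close>

lemma circle_integrable_bounded_mult:
  fixes u :: "complex \<Rightarrow> real" and k :: "complex \<Rightarrow> complex"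
  assumes u: "integrable circle_measure u" and [measurable]: "k \<in> borel_measurable borel"
    and k: "\<And>\<zeta>. norm \<zeta> = 1 \<Longrightarrow> u \<zeta> \<noteq> 0 \<Longrightarrow> norm (k \<zeta>) \<le> B"
  shows "integrable circle_measure (\<lambda>\<zeta>. k \<zeta> * complex_of_real (u \<zeta>))"
proof (rule Bochner_Integration.integrable_bound)
  note [measurable] = borel_measurable_circle_integrable[OF u]
  show "(\<lambda>\<zeta>. k \<zeta> * complex_of_real (u \<zeta>)) \<in> borel_measurable circle_measure"
    by measurable
  show "integrable circle_measure (\<lambda>\<zeta>. B * norm (u \<zeta>))"
    using u by (intro integrable_mult_right integrable_norm)
  show "AE \<zeta> in circle_measure. norm (k \<zeta> * complex_of_real (u \<zeta>)) \<le> norm (B * norm (u \<zeta>))"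
    using AE_circle_measure_norm
  proof eventually_elim
    fix \<zeta> :: complex assume "norm \<zeta> = 1"
    then have "norm (k \<zeta> * complex_of_real (u \<zeta>)) \<le> B * norm (u \<zeta>)"
      using k[of \<zeta>] by (cases "u \<zeta> = 0") (auto simp: norm_mult intro!: mult_right_mono)
    also have "\<dots> \<le> norm (B * norm (u \<zeta>))" by simp
    finally show "norm (k \<zeta> * complex_of_real (u \<zeta>)) \<le> norm (B * norm (u \<zeta>))" .
  qed
qed

text \<open>Dominated convergence along sequences with a multiple of \<open>norm (u \<zeta>)\<close>
  as majorant. It serves both complex differentiation inside the disk and limits at boundary
  points.\<close>

lemma circle_integral_tendsto:
  fixes u :: "complex \<Rightarrow> real" and k :: "complex \<Rightarrow> complex \<Rightarrow> complex"
  assumes u: "integrable circle_measure u"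
    and k[measurable]: "\<And>w. k w \<in> borel_measurable borel"
    and bound: "\<And>w \<zeta>. w \<in> S \<Longrightarrow> norm \<zeta> = 1 \<Longrightarrow> u \<zeta> \<noteq> 0 \<Longrightarrow> norm (k w \<zeta>) \<le> B"
    and lim: "\<And>\<zeta>. norm \<zeta> = 1 \<Longrightarrow> u \<zeta> \<noteq> 0 \<Longrightarrow> ((\<lambda>w. k w \<zeta>) \<longlongrightarrow> k z \<zeta>) (at z within S)"
  shows "((\<lambda>w. LINT \<zeta>|circle_measure. k w \<zeta> * complex_of_real (u \<zeta>)) \<longlongrightarrow>
           (LINT \<zeta>|circle_measure. k z \<zeta> * complex_of_real (u \<zeta>))) (at z within S)"
  unfolding tendsto_at_iff_sequentially comp_def
proof (intro allI impI)
  fix X :: "nat \<Rightarrow> complex" assume X: "\<forall>i. X i \<in> S - {z}" "X \<longlonglongrightarrow> z"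
  note [measurable] = borel_measurable_circle_integrable[OF u]
  show "(\<lambda>n. LINT \<zeta>|circle_measure. k (X n) \<zeta> * complex_of_real (u \<zeta>)) \<longlonglongrightarrow>
           (LINT \<zeta>|circle_measure. k z \<zeta> * complex_of_real (u \<zeta>))"
  proof (rule integral_dominated_convergence)
    show "integrable circle_measure (\<lambda>\<zeta>. B * norm (u \<zeta>))"
      using u by (intro integrable_mult_right integrable_norm)
    show "AE \<zeta> in circle_measure. norm (k (X n) \<zeta> * complex_of_real (u \<zeta>)) \<le> B * norm (u \<zeta>)" for n
      using AE_circle_measure_norm
    proof eventually_elim
      fix \<zeta> :: complex assume "norm \<zeta> = 1"
      then show "norm (k (X n) \<zeta> * complex_of_real (u \<zeta>)) \<le> B * norm (u \<zeta>)"
        using bound[of "X n" \<zeta>] X(1) by (cases "u \<zeta> = 0") (auto simp: norm_mult intro!: mult_right_mono)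
    qed
    show "AE \<zeta> in circle_measure. (\<lambda>n. k (X n) \<zeta> * complex_of_real (u \<zeta>)) \<longlonglongrightarrow> k z \<zeta> * complex_of_real (u \<zeta>)"
      using AE_circle_measure_norm
    proof eventually_elim
      fix \<zeta> :: complex assume \<zeta>: "norm \<zeta> = 1"
      show "(\<lambda>n. k (X n) \<zeta> * complex_of_real (u \<zeta>)) \<longlonglongrightarrow> k z \<zeta> * complex_of_real (u \<zeta>)"
      proof (cases "u \<zeta> = 0")
        case False
        then have "(\<lambda>n. k (X n) \<zeta>) \<longlonglongrightarrow> k z \<zeta>"
          using lim[OF \<zeta>] X unfolding tendsto_at_iff_sequentially comp_def by blast
        then show ?thesis by (intro tendsto_intros)
      qed simp
    qed
  qed measurable
qed

lemma norm_diff_sphere_ge: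
  fixes \<zeta> w :: complex
  assumes "norm \<zeta> = 1"
  shows "1 - norm w \<le> norm (\<zeta> - w)"
  using norm_triangle_ineq2[of \<zeta> w] assms by simp

lemma herglotz_integrable:
  assumes u: "integrable circle_measure u" and z: "norm z < 1"
  shows "integrable circle_measure (\<lambda>\<zeta>. (\<zeta> + z) / (\<zeta> - z) * complex_of_real (u \<zeta>))"
proof (rule circle_integrable_bounded_mult[OF u])
  fix \<zeta> :: complex assume \<zeta>: "norm \<zeta> = 1"
  have "norm (\<zeta> + z) \<le> 2"
    using norm_triangle_ineq[of \<zeta> z] \<zeta> z by simp
  then show "norm ((\<zeta> + z) / (\<zeta> - z)) \<le> 2 / (1 - norm z)"
    unfolding norm_divide using norm_diff_sphere_ge[OF \<zeta>, of z] z by (intro frac_le) auto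
qed measurable

text \<open>The difference of two kernels factors as
  \<open>(w - z) * (2 * \<zeta> / ((\<zeta> - w) * (\<zeta> - z)))\<close>. The difference quotient
  is therefore the integral \<open>Q w\<close>, and continuity of \<open>Q\<close> at
  \<open>z\<close> gives the derivative.\<close>

lemma herglotz_holomorphic:
  assumes u: "integrable circle_measure u"
  shows "herglotz u holomorphic_on ball 0 1"
proof (rule holomorphic_onI)
  fix z :: complex assume "z \<in> ball 0 1"
  then have z: "norm z < 1" by simp
  \<comment> \<open>Half the distance to the circle, so that all of \<open>ball z d\<close> stays at
    distance at least \<open>d\<close> from it.\<close>
  define d where "d = (1 - norm z) / 2"
  have d: "d > 0" using z by (simp add: d_def)
  define Q where "Q = (\<lambda>w. LINT \<zeta>|circle_measure. (2 * \<zeta> / ((\<zeta> - w) * (\<zeta> - z))) * complex_of_real (u \<zeta>))"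
  have far: "d \<le> norm (\<zeta> - w)" "norm w < 1" if "w \<in> ball z d" "norm \<zeta> = 1" for w \<zeta> :: complex
  proof -
    have *: "norm w < norm z + d"
      using that(1) norm_triangle_ineq[of z "w - z"] by (simp add: dist_norm norm_minus_commute)
    then show "d \<le> norm (\<zeta> - w)"
      using norm_diff_sphere_ge[OF that(2), of w] by (simp add: d_def field_simps)
    show "norm w < 1"
      using * z by (simp add: d_def field_simps)
  qed
  have z_in: "z \<in> ball z d" using d by simp
  have "(Q \<longlongrightarrow> Q z) (at z within ball z d)"
    unfolding Q_def
  proof (rule circle_integral_tendsto[OF u])
    fix w \<zeta> :: complex assume w: "w \<in> ball z d" and \<zeta>: "norm \<zeta> = 1"
    have "d * d \<le> norm (\<zeta> - w) * norm (\<zeta> - z)"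
      using far[OF w \<zeta>] far[OF z_in \<zeta>] d by (intro mult_mono) auto
    then show "norm (2 * \<zeta> / ((\<zeta> - w) * (\<zeta> - z))) \<le> 2 / (d * d)"
      unfolding norm_divide norm_mult using \<zeta> d by (simp add: frac_le)
  next
    fix \<zeta> :: complex assume \<zeta>: "norm \<zeta> = 1"
    then have "\<zeta> \<noteq> z" using z by auto
    then show "((\<lambda>w. 2 * \<zeta> / ((\<zeta> - w) * (\<zeta> - z))) \<longlongrightarrow> 2 * \<zeta> / ((\<zeta> - z) * (\<zeta> - z))) (at z within ball z d)"
      by (intro tendsto_intros) auto
  qed measurable
  then have Q: "(Q \<longlongrightarrow> Q z) (at z)"
    using at_within_open[of z "ball z d"] d by simp
  have "eventually (\<lambda>w. w \<in> ball z d \<and> w \<noteq> z) (at z)"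
    using d by (intro eventually_conj eventually_at_in_open') (auto simp: eventually_at_filter)
  then have "eventually (\<lambda>w. Q w = (herglotz u w - herglotz u z) / (w - z)) (at z)"
  proof eventually_elim
    fix w assume w: "w \<in> ball z d \<and> w \<noteq> z"
    note [measurable] = borel_measurable_circle_integrable[OF u]
    have nw: "norm w < 1" using far(2)[of w 1] w by simp
    have "herglotz u w - herglotz u z =
        (LINT \<zeta>|circle_measure. (\<zeta> + w) / (\<zeta> - w) * complex_of_real (u \<zeta>) - (\<zeta> + z) / (\<zeta> - z) * complex_of_real (u \<zeta>))"
      unfolding herglotz_def
      by (rule Bochner_Integration.integral_diff[symmetric]) (intro herglotz_integrable u nw z)+
    also have "\<dots> = (LINT \<zeta>|circle_measure. (w - z) * ((2 * \<zeta> / ((\<zeta> - w) * (\<zeta> - z))) * complex_of_real (u \<zeta>)))"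
    proof (rule integral_cong_AE)
      show "AE \<zeta> in circle_measure. (\<zeta> + w) / (\<zeta> - w) * complex_of_real (u \<zeta>) - (\<zeta> + z) / (\<zeta> - z) * complex_of_real (u \<zeta>)
          = (w - z) * ((2 * \<zeta> / ((\<zeta> - w) * (\<zeta> - z))) * complex_of_real (u \<zeta>))"
        using AE_circle_measure_norm
      proof eventually_elim
        fix \<zeta> :: complex assume "norm \<zeta> = 1"
        then have ne: "\<zeta> - w \<noteq> 0" "\<zeta> - z \<noteq> 0" using nw z by auto
        then show "(\<zeta> + w) / (\<zeta> - w) * complex_of_real (u \<zeta>) - (\<zeta> + z) / (\<zeta> - z) * complex_of_real (u \<zeta>)
          = (w - z) * ((2 * \<zeta> / ((\<zeta> - w) * (\<zeta> - z))) * complex_of_real (u \<zeta>))"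
          by (simp add: divide_simps) (simp add: algebra_simps)
      qed
    qed measurable
    also have "\<dots> = (w - z) * Q w"
      unfolding Q_def by (simp del: times_divide_eq_left times_divide_eq_right)
    finally show "Q w = (herglotz u w - herglotz u z) / (w - z)"
      using w by simp
  qed
  with Q have "((\<lambda>w. (herglotz u w - herglotz u z) / (w - z)) \<longlongrightarrow> Q z) (at z)"
    by (rule Lim_transform_eventually)
  then have "(herglotz u has_field_derivative Q z) (at z)"
    by (simp add: has_field_derivative_iff)
  then show "herglotz u field_differentiable (at z within ball 0 1)"
    using field_differentiable_at_within field_differentiable_def by blast
qed

text \<open>For \<open>norm \<zeta> = 1\<close> this is the Poisson kernel. It is nonnegative for
  \<open>z\<close> in the disk and vanishes for \<open>z\<close> on the circle; the first fact gives
  positivity, the second the real part of boundary limits.\<close>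

lemma Re_herglotz_kernel:
  "Re ((\<zeta> + z) / (\<zeta> - z)) = ((norm \<zeta>)\<^sup>2 - (norm z)\<^sup>2) / (norm (\<zeta> - z))\<^sup>2"
  unfolding Re_divide cmod_power2 by (simp add: power2_eq_square algebra_simps)

lemma Re_herglotz_nonneg:
  assumes u: "integrable circle_measure u" "\<And>\<zeta>. 0 \<le> u \<zeta>" and z: "norm z < 1"
  shows "0 \<le> Re (herglotz u z)"
proof -
  have "Re (herglotz u z) = (LINT \<zeta>|circle_measure. Re ((\<zeta> + z) / (\<zeta> - z) * complex_of_real (u \<zeta>)))"
    unfolding herglotz_def by (rule integral_Re[OF herglotz_integrable[OF u(1) z], symmetric])
  also have "\<dots> \<ge> 0"
  proof (rule integral_nonneg_AE)
    show "AE \<zeta> in circle_measure. 0 \<le> Re ((\<zeta> + z) / (\<zeta> - z) * complex_of_real (u \<zeta>))"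
      using AE_circle_measure_norm
    proof eventually_elim
      fix \<zeta> :: complex assume "norm \<zeta> = 1"
      then have "0 \<le> Re ((\<zeta> + z) / (\<zeta> - z))"
        unfolding Re_herglotz_kernel using z by (simp add: power_le_one)
      then show "0 \<le> Re ((\<zeta> + z) / (\<zeta> - z) * complex_of_real (u \<zeta>))"
        using u(2)[of \<zeta>] by (simp del: times_divide_eq_left)
    qed
  qed
  finally show ?thesis .
qed

text \<open>The kernel equals \<open>2 * (\<zeta> / (\<zeta> - z)) - 1\<close>, so Cauchy's formula
  gives it the integral 2 - 1 = 1.\<close>

lemma herglotz_const:
  assumes z: "norm z < 1"
  shows "herglotz (\<lambda>_. c) z = c"
proof -
  have i: "integrable circle_measure (\<lambda>\<zeta>. \<zeta> / (\<zeta> - z))"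
  proof -
    have "norm (\<zeta> / (\<zeta> - z)) \<le> 1 / (1 - norm z)" if "norm \<zeta> = 1" for \<zeta> :: complex
      unfolding norm_divide using norm_diff_sphere_ge[OF that, of z] z that by (intro frac_le) auto
    then show ?thesis
      using circle_integrable_bounded_mult[of "\<lambda>_. 1" "\<lambda>\<zeta>. \<zeta> / (\<zeta> - z)" "1 / (1 - norm z)"] by simp
  qed
  have "herglotz (\<lambda>_. c) z = (LINT \<zeta>|circle_measure. (\<zeta> + z) / (\<zeta> - z)) * c"
    unfolding herglotz_def by (simp del: times_divide_eq_left)
  also have "(LINT \<zeta>|circle_measure. (\<zeta> + z) / (\<zeta> - z)) = (LINT \<zeta>|circle_measure. 2 * (\<zeta> / (\<zeta> - z)) - 1)"
  proof (rule integral_cong_AE)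
    show "AE \<zeta> in circle_measure. (\<zeta> + z) / (\<zeta> - z) = 2 * (\<zeta> / (\<zeta> - z)) - 1"
      using AE_circle_measure_norm
    proof eventually_elim
      fix \<zeta> :: complex assume "norm \<zeta> = 1"
      then have "\<zeta> - z \<noteq> 0" using z by auto
      then show "(\<zeta> + z) / (\<zeta> - z) = 2 * (\<zeta> / (\<zeta> - z)) - 1"
        by (simp add: divide_simps)
    qed
  qed measurable
  also have "\<dots> = 1"
    using i circle_integral_Cauchy[OF z] circle.prob_space
    by (subst Bochner_Integration.integral_diff) (auto simp del: times_divide_eq_right)
  finally show ?thesis by simp
qed

text \<open>Subtracting \<open>c\<close> leaves a function \<open>v\<close> that vanishes on the
  circle near \<open>\<zeta>1\<close>. Its Herglotz integral has a limit there since the kernel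
  stays bounded where \<open>v\<close> is nonzero, and the limit is purely imaginary because the
  kernel is so on the circle.\<close>

lemma herglotz_limit_locally_const:
  assumes u: "integrable circle_measure u" and \<zeta>1: "norm \<zeta>1 = 1" and d: "d > 0"
    and const: "\<And>\<zeta>. norm \<zeta> = 1 \<Longrightarrow> dist \<zeta> \<zeta>1 < d \<Longrightarrow> u \<zeta> = c"
  shows "\<exists>l. Re l = c \<and> (herglotz u \<longlongrightarrow> l) (at \<zeta>1 within ball 0 1)"
proof -
  define v where "v = (\<lambda>\<zeta>. u \<zeta> - c)"
  have v: "integrable circle_measure v"
    unfolding v_def using u by simp
  have far: "d \<le> dist \<zeta> \<zeta>1" if "norm \<zeta> = 1" "v \<zeta> \<noteq> 0" for \<zeta>
    using const[OF that(1)] that(2) by (force simp: v_def)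
  \<comment> \<open>Points of \<open>S\<close> keep distance at least \<open>d / 2\<close> from
    every point of the circle where \<open>v\<close> is nonzero; shrinking the disk to
    \<open>S\<close> does not change the limit at \<open>\<zeta>1\<close>.\<close>
  define S where "S = ball 0 1 \<inter> ball \<zeta>1 (d/2)"
  have "((\<lambda>w. LINT \<zeta>|circle_measure. (\<zeta> + w) / (\<zeta> - w) * complex_of_real (v \<zeta>)) \<longlongrightarrow>
      (LINT \<zeta>|circle_measure. (\<zeta> + \<zeta>1) / (\<zeta> - \<zeta>1) * complex_of_real (v \<zeta>))) (at \<zeta>1 within S)"
  proof (rule circle_integral_tendsto[OF v])
    fix w \<zeta> assume w: "w \<in> S" and \<zeta>: "norm \<zeta> = 1" "v \<zeta> \<noteq> 0"
    have "norm (\<zeta> + w) \<le> 2"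
      using norm_triangle_ineq[of \<zeta> w] w \<zeta> by (simp add: S_def)
    moreover have "d / 2 \<le> norm (\<zeta> - w)"
      using far[OF \<zeta>] w dist_triangle[of \<zeta> \<zeta>1 w] by (simp add: S_def dist_norm norm_minus_commute)
    ultimately show "norm ((\<zeta> + w) / (\<zeta> - w)) \<le> 2 / (d / 2)"
      unfolding norm_divide using d by (intro frac_le) auto
  next
    fix \<zeta> assume "norm \<zeta> = 1" "v \<zeta> \<noteq> 0"
    then have "\<zeta> \<noteq> \<zeta>1" using far[of \<zeta>] d by auto
    then show "((\<lambda>w. (\<zeta> + w) / (\<zeta> - w)) \<longlongrightarrow> (\<zeta> + \<zeta>1) / (\<zeta> - \<zeta>1)) (at \<zeta>1 within S)"
      by (intro tendsto_intros) auto
  qed measurable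
  moreover have "at \<zeta>1 within S = at \<zeta>1 within ball 0 1"
    unfolding S_def using d by (intro at_within_nhd[of _ "ball \<zeta>1 (d/2)"]) auto
  ultimately have lim: "(herglotz v \<longlongrightarrow> herglotz v \<zeta>1) (at \<zeta>1 within ball 0 1)"
    unfolding herglotz_def[abs_def] by simp
  have "Re (herglotz v \<zeta>1) = (LINT \<zeta>|circle_measure. Re ((\<zeta> + \<zeta>1) / (\<zeta> - \<zeta>1) * complex_of_real (v \<zeta>)))"
    unfolding herglotz_def
  proof (rule integral_Re[symmetric], rule circle_integrable_bounded_mult[OF v])
    fix \<zeta> assume \<zeta>: "norm \<zeta> = 1" "v \<zeta> \<noteq> 0"
    show "norm ((\<zeta> + \<zeta>1) / (\<zeta> - \<zeta>1)) \<le> 2 / d"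
      unfolding norm_divide using d far[OF \<zeta>] norm_triangle_ineq[of \<zeta> \<zeta>1] \<zeta> \<zeta>1
      by (intro frac_le) (auto simp: dist_norm)
  qed measurable
  also have "\<dots> = (LINT \<zeta>|circle_measure. 0)"
  proof (rule integral_cong_AE)
    note [measurable] = borel_measurable_circle_integrable[OF v]
    show "(\<lambda>\<zeta>. Re ((\<zeta> + \<zeta>1) / (\<zeta> - \<zeta>1) * complex_of_real (v \<zeta>))) \<in> borel_measurable circle_measure"
      by measurable
    show "AE \<zeta> in circle_measure. Re ((\<zeta> + \<zeta>1) / (\<zeta> - \<zeta>1) * complex_of_real (v \<zeta>)) = 0"
      using AE_circle_measure_norm
    proof eventually_elim
      fix \<zeta> :: complex assume "norm \<zeta> = 1"
      then have "Re ((\<zeta> + \<zeta>1) / (\<zeta> - \<zeta>1)) = 0"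
        unfolding Re_herglotz_kernel using \<zeta>1 by simp
      then show "Re ((\<zeta> + \<zeta>1) / (\<zeta> - \<zeta>1) * complex_of_real (v \<zeta>)) = 0"
        by (simp del: times_divide_eq_left)
    qed
  qed simp
  finally have "Re (c + herglotz v \<zeta>1) = c" by simp
  moreover have "(herglotz u \<longlongrightarrow> c + herglotz v \<zeta>1) (at \<zeta>1 within ball 0 1)"
  proof (rule Lim_transform_eventually)
    show "((\<lambda>z. c + herglotz v z) \<longlongrightarrow> c + herglotz v \<zeta>1) (at \<zeta>1 within ball 0 1)"
      by (intro tendsto_intros lim)
    show "eventually (\<lambda>z. c + herglotz v z = herglotz u z) (at \<zeta>1 within ball 0 1)"
      unfolding eventually_at_filter
    proof (intro always_eventually allI impI)
      fix z :: complex assume "z \<in> ball 0 1"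
      then have z: "norm z < 1" by simp
      have "herglotz (\<lambda>_. c) z + herglotz v z =
        (LINT \<zeta>|circle_measure. (\<zeta> + z) / (\<zeta> - z) * complex_of_real c + (\<zeta> + z) / (\<zeta> - z) * complex_of_real (v \<zeta>))"
        unfolding herglotz_def
        by (rule Bochner_Integration.integral_add[symmetric])
          (intro herglotz_integrable v z circle.integrable_const)+
      also have "\<dots> = herglotz u z"
        unfolding herglotz_def
        by (intro Bochner_Integration.integral_cong refl) (simp add: v_def flip: distrib_left of_real_add del: times_divide_eq_left)
      finally show "c + herglotz v z = herglotz u z"
        using herglotz_const[OF z] by simp
    qed
  qed
  ultimately show ?thesis by blast
qed

section \<open>Stolz regions, non-tangential limits and boundary values\<close>

lemma islimpt_stolz_region:
  assumes "norm \<zeta> = 1" "\<alpha> > 1"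
  shows "\<zeta> islimpt stolz_region \<zeta> \<alpha>"
  unfolding islimpt_approachable
proof (intro allI impI)
  fix e :: real assume e: "e > 0"
  \<comment> \<open>Approach along the radius: there \<open>dist z \<zeta> = 1 - norm z\<close>,
    which satisfies the Stolz inequality for every \<open>\<alpha> > 1\<close>.\<close>
  define \<delta> where "\<delta> = min (e/2) (1/2)"
  have \<delta>: "0 < \<delta>" "\<delta> < e" "\<delta> < 1" using e by (auto simp: \<delta>_def min_def)
  define z where "z = of_real (1 - \<delta>) * \<zeta>"
  have n: "norm z = 1 - \<delta>" using assms \<delta> unfolding z_def norm_mult norm_of_real by simp
  have "z - \<zeta> = of_real (-\<delta>) * \<zeta>" by (simp add: z_def algebra_simps)
  then have dz: "dist z \<zeta> = \<delta>" using assms(1) \<delta> unfolding dist_norm by (simp only: norm_mult norm_of_real)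
  have "z \<in> stolz_region \<zeta> \<alpha>"
    using n dz \<delta> assms(2) by (simp add: stolz_region_def)
  moreover have "z \<noteq> \<zeta>" using dz \<delta> by auto
  ultimately show "\<exists>x'\<in>stolz_region \<zeta> \<alpha>. x' \<noteq> \<zeta> \<and> dist x' \<zeta> < e"
    using dz \<delta> by auto
qed

text \<open>Uniqueness of the limit follows already within one Stolz region, since the boundary
  point is a limit point of it.\<close>

lemma boundary_value_eqI:
  assumes "norm \<zeta> = 1" and L: "has_nontangential_limit f \<zeta> L"
  shows "boundary_value f \<zeta> = L"
  unfolding boundary_value_def
proof (rule the_equality[of "has_nontangential_limit f \<zeta>", OF L])
  fix L' assume "has_nontangential_limit f \<zeta> L'"
  then have "(f \<longlongrightarrow> L') (at \<zeta> within stolz_region \<zeta> 2)" "(f \<longlongrightarrow> L) (at \<zeta> within stolz_region \<zeta> 2)"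
    using L by (auto simp: has_nontangential_limit_def)
  moreover have "\<not> trivial_limit (at \<zeta> within stolz_region \<zeta> 2)"
    using islimpt_stolz_region[OF assms(1), of 2] by (simp add: trivial_limit_within)
  ultimately show "L' = L" using tendsto_unique by blast
qed

text \<open>The junk value does not depend on the point, so points without a limit contribute at most a
  constant to an integral over the circle. Hence the existence of limits need not be known for \<open>g\<close>.\<close>

lemma boundary_value_junk:
  assumes "\<nexists>L. has_nontangential_limit f \<zeta> L"
  shows "boundary_value f \<zeta> = (THE L. False)"
  using assms by (simp add: boundary_value_def)

lemma has_nontangential_limitI:
  assumes "(f \<longlongrightarrow> L) (at \<zeta> within ball 0 1)"
  shows "has_nontangential_limit f \<zeta> L"
  unfolding has_nontangential_limit_def
  by (intro allI impI tendsto_within_subset[OF assms]) (auto simp: stolz_region_def)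

lemma has_nontangential_limit_power_mult:
  assumes "has_nontangential_limit f \<zeta> L" "has_nontangential_limit g \<zeta> M"
  shows "has_nontangential_limit (\<lambda>z. f z ^ n * g z) \<zeta> (L ^ n * M)"
  using assms unfolding has_nontangential_limit_def by (auto intro!: tendsto_intros)

text \<open>For \<open>u \<ge> 0\<close> the function \<open>exp (- herglotz u z)\<close> is bounded
  by 1 and outer, with boundary data \<open>- u\<close>, so its reciprocal is a quotient of the
  required kind with numerator 1.\<close>

lemma exp_herglotz_Smirnov:
  assumes u: "integrable circle_measure u" "\<And>\<zeta>. 0 \<le> u \<zeta>"
  shows "(\<lambda>z. exp (herglotz u z)) \<in> Smirnov"
proof -
  have hol: "(\<lambda>z. exp (herglotz u z)) holomorphic_on ball 0 1" "(\<lambda>z. exp (- herglotz u z)) holomorphic_on ball 0 1"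
    by (intro holomorphic_intros herglotz_holomorphic u)+
  have b: "bounded ((\<lambda>z. exp (- herglotz u z)) ` ball 0 1)"
    using Re_herglotz_nonneg[OF u] by (intro boundedI[of _ 1]) auto
  have o: "outer_function (\<lambda>z. exp (- herglotz u z))"
    unfolding outer_function_def
  proof (intro exI[of _ 1] exI[of _ "\<lambda>\<zeta>. - u \<zeta>"] conjI ballI)
    fix z :: complex
    have "(LINT \<zeta>|circle_measure. (\<zeta> + z) / (\<zeta> - z) * complex_of_real (- u \<zeta>)) = - herglotz u z"
      unfolding herglotz_def by simp
    then show "exp (- herglotz u z) = 1 * exp (LINT \<zeta>|circle_measure. (\<zeta> + z) / (\<zeta> - z) * complex_of_real (- u \<zeta>))"
      by simp
  qed (use u in auto)
  have "\<forall>z\<in>ball 0 1. exp (herglotz u z) = 1 / exp (- herglotz u z)"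
    by (simp add: exp_minus field_simps)
  moreover have "bounded ((\<lambda>_. 1::complex) ` ball (0::complex) 1)"
    by (simp add: image_constant_conv)
  ultimately have "\<exists>a b. a \<in> Hol_disk \<and> bounded (a ` ball 0 1) \<and> b \<in> Hol_disk \<and> bounded (b ` ball 0 1) \<and>
      outer_function b \<and> (\<forall>z\<in>ball 0 1. exp (herglotz u z) = a z / b z)"
    using hol b o
    by (intro exI[of _ "\<lambda>_. 1"] exI[of _ "\<lambda>z. exp (- herglotz u z)"]) (simp add: Hol_disk_def)
  then show ?thesis
    using hol by (simp add: Smirnov_def Hol_disk_def)
qed

section \<open>The test function\<close>

lemma strongly_convex_eventually_ge:
  assumes "strongly_convex \<phi>"
  obtains T where "T > 0" "\<And>t. t \<ge> T \<Longrightarrow> t \<le> \<phi> t"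
proof -
  have "eventually (\<lambda>t. 1 \<le> \<phi> t / t) at_top"
    using assms by (auto simp: strongly_convex_def filterlim_at_top)
  then obtain T where T: "\<And>t. t \<ge> T \<Longrightarrow> 1 \<le> \<phi> t / t"
    by (auto simp: eventually_at_top_linorder)
  show thesis
  proof (rule that[of "max T 1"])
    fix t assume "max T 1 \<le> t"
    then show "t \<le> \<phi> t" using T[of t] by (simp add: field_simps)
  qed simp
qed

lemma strongly_convex_right_inverse:
  assumes \<phi>: "strongly_convex \<phi>" "strict_mono \<phi>"
  obtains \<psi> where "mono \<psi>" "\<And>y. 0 \<le> \<psi> y" "\<And>y. \<phi> 0 \<le> y \<Longrightarrow> \<phi> (\<psi> y) = y"
proof -
  obtain T where T: "T > 0" "\<And>t. t \<ge> T \<Longrightarrow> t \<le> \<phi> t"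
    using strongly_convex_eventually_ge[OF \<phi>(1)] by blast
  have cont: "continuous_on UNIV \<phi>"
    using \<phi>(1) by (intro convex_on_continuous) (auto simp: strongly_convex_def)
  \<comment> \<open>Clamping \<open>y\<close> from below at \<open>\<phi> 0\<close> makes the
    inverse total, nonnegative and monotone; monotonicity later yields its measurability.\<close>
  have "\<exists>t\<ge>0. \<phi> t = max y (\<phi> 0)" for y
  proof -
    define b where "b = max T (max y (\<phi> 0))"
    have "max y (\<phi> 0) \<le> \<phi> b" using T(2)[of b] by (auto simp: b_def)
    moreover have "0 \<le> b" using T(1) by (auto simp: b_def)
    ultimately show ?thesis
      using IVT'[of \<phi> 0 "max y (\<phi> 0)" b] continuous_on_subset[OF cont] by auto
  qed
  then obtain \<psi> where \<psi>: "\<And>y. 0 \<le> \<psi> y" "\<And>y. \<phi> (\<psi> y) = max y (\<phi> 0)" by metis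
  have "mono \<psi>"
  proof
    fix x y :: real assume "x \<le> y"
    then have "\<phi> (\<psi> x) \<le> \<phi> (\<psi> y)" by (auto simp: \<psi>)
    then show "\<psi> x \<le> \<psi> y" using strict_mono_less_eq[OF \<phi>(2)] by blast
  qed
  with \<psi> show thesis by (intro that[of \<psi>]) auto
qed

text \<open>The value 0 marks the default branch of \<open>gamma_inverse\<close>. A nonzero value
  therefore excludes \<open>r \<le> 0\<close> and places \<open>real n * ln r\<close> above the
  infimum of \<open>\<gamma>\<close>, hence in its range, because a concave function on an open
  interval is continuous and \<open>\<gamma>\<close> is unbounded.\<close>

lemma gamma_inverse_eq:
  assumes \<gamma>: "nabla_admissible \<phi> \<gamma>" and n: "n \<ge> 1"
    and ne: "gamma_inverse \<gamma> (ereal (real n) * log_ext r) \<noteq> 0"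
  shows "0 < r" and "0 < gamma_inverse \<gamma> (ereal (real n) * log_ext r)"
    and "\<gamma> (gamma_inverse \<gamma> (ereal (real n) * log_ext r)) = real n * ln r"
proof -
  show r: "0 < r"
  proof (rule ccontr)
    assume "\<not> 0 < r"
    then have "ereal (real n) * log_ext r = -\<infinity>" using n by (simp add: log_ext_def)
    then show False using ne by (simp add: gamma_inverse_def)
  qed
  define x where "x = real n * ln r"
  have x: "ereal (real n) * log_ext r = ereal x" using r by (simp add: log_ext_def x_def)
  have "\<not> ereal x \<le> (INF s\<in>{0<..}. ereal (\<gamma> s))"
    using ne unfolding x gamma_inverse_def by (auto split: if_splits)
  then obtain s where s: "s > 0" "\<gamma> s < x"
    by (auto simp: le_INF_iff not_le)
  have "eventually (\<lambda>t. x \<le> \<gamma> t) at_top"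
    using \<gamma> by (auto simp: nabla_admissible_def filterlim_at_top)
  then obtain b where b: "\<And>t. t \<ge> b \<Longrightarrow> x \<le> \<gamma> t" by (auto simp: eventually_at_top_linorder)
  have "convex_on {0<..} (\<lambda>t. - \<gamma> t)"
    using \<gamma> by (simp add: nabla_admissible_def concave_on_def)
  then have "continuous_on {0<..} (\<lambda>t. - (- \<gamma> t))"
    by (intro continuous_on_minus convex_on_continuous) auto
  then have "continuous_on {s..max s b} \<gamma>"
    using s(1) by (auto elim!: continuous_on_subset)
  then obtain t where t: "s \<le> t" "\<gamma> t = x"
    using IVT'[of \<gamma> s x "max s b"] s b[of "max s b"] by auto
  have inj: "inj_on \<gamma> {0<..}"
    using \<gamma> by (intro strict_mono_on_imp_inj_on) (simp add: nabla_admissible_def)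
  have mem: "x \<in> \<gamma> ` {0<..}" using t s by auto
  have "gamma_inverse \<gamma> (ereal (real n) * log_ext r) = the_inv_into {0<..} \<gamma> x"
    using \<open>\<not> ereal x \<le> _\<close> unfolding x gamma_inverse_def by simp
  then show "0 < gamma_inverse \<gamma> (ereal (real n) * log_ext r)"
    and "\<gamma> (gamma_inverse \<gamma> (ereal (real n) * log_ext r)) = real n * ln r"
    using the_inv_into_into[OF inj mem order_refl] f_the_inv_into_f[OF inj mem] by (auto simp: x_def)
qed

lemma comp_log_exp [simp]: "comp_log \<phi> (exp x) = \<phi> x"
  by (simp add: comp_log_def log_ext_def)

lemma eventually_indicator_eq_off_frontier:
  assumes "x \<notin> frontier U"
  shows "eventually (\<lambda>y. indicator U y = (indicator U x :: real)) (nhds x)"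
proof (cases "x \<in> interior U")
  case True
  then have "eventually (\<lambda>y. y \<in> interior U) (nhds x)"
    by (intro eventually_nhds_in_open) auto
  then show ?thesis
    using True interior_subset[of U] by (auto elim!: eventually_mono split: split_indicator)
next
  case False
  then have "x \<in> - closure U" using assms by (auto simp: frontier_def)
  moreover from this have "eventually (\<lambda>y. y \<in> - closure U) (nhds x)"
    by (intro eventually_nhds_in_open) auto
  ultimately show ?thesis
    using closure_subset[of U] by (auto elim!: eventually_mono split: split_indicator)
qed

text \<open>With \<open>\<phi> (u \<zeta>) = S \<zeta>\<close>, membership of the outer function in
  the class reduces to integrability of the step sum \<open>S\<close>. The bound is phrased through
  \<open>\<phi> a \<le> p j\<close>, so that \<open>u\<close> itself need not be exposed.\<close>

lemma Hardy_Orlicz_test_function: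
  fixes U :: "nat \<Rightarrow> complex set" and p :: "nat \<Rightarrow> real"
  assumes \<phi>: "strongly_convex \<phi>" "strict_mono \<phi>"
    and U: "\<And>j. open (U j)" "\<And>j. U j \<subseteq> ball \<zeta>0 (1 / Suc j) - {\<zeta>0}"
      "\<And>j. measure circle_measure (frontier (U j)) = 0"
    and p: "\<And>j. 0 \<le> p j" "summable (\<lambda>j. p j * measure circle_measure (U j))"
  obtains f where "f \<in> Hardy_Orlicz (comp_log \<phi>)"
    "AE \<zeta> in circle_measure. \<exists>M. has_nontangential_limit f \<zeta> M \<and> (\<forall>j a. \<zeta> \<in> U j \<longrightarrow> \<phi> a \<le> p j \<longrightarrow> exp a \<le> norm M)"
proof -
  obtain \<psi> where \<psi>: "mono \<psi>" "\<And>y. 0 \<le> \<psi> y" "\<And>y. \<phi> 0 \<le> y \<Longrightarrow> \<phi> (\<psi> y) = y"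
    using strongly_convex_right_inverse[OF \<phi>] by blast
  have [measurable]: "\<psi> \<in> borel_measurable borel"
    using \<psi>(1) by (rule borel_measurable_mono)
  have [measurable]: "U j \<in> sets borel" for j using U(1) by simp
  have \<phi>_nonneg: "0 \<le> \<phi> t" for t using \<phi>(1) by (simp add: strongly_convex_def)
  obtain T where T: "T > 0" "\<And>t. t \<ge> T \<Longrightarrow> t \<le> \<phi> t"
    using strongly_convex_eventually_ge[OF \<phi>(1)] by blast
  \<comment> \<open>The summand \<open>\<phi> 0\<close> keeps \<open>S\<close> in the range where
    \<open>\<psi>\<close> inverts \<open>\<phi>\<close>.\<close>
  define S where "S = (\<lambda>\<zeta>. \<phi> 0 + (\<Sum>j. p j * indicator (U j) \<zeta>))"
  define u where "u = (\<lambda>\<zeta>. \<psi> (S \<zeta>))"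
  \<comment> \<open>Away from \<open>\<zeta>0\<close> only finitely many \<open>U j\<close> meet a
    small ball. This yields pointwise convergence of the series and, later, local constancy of
    \<open>u\<close>.\<close>
  have far: "\<exists>J. \<forall>j\<ge>J. \<forall>\<xi>\<in>ball \<zeta> (dist \<zeta> \<zeta>0 / 2). \<xi> \<notin> U j" if "\<zeta> \<noteq> \<zeta>0" for \<zeta>
  proof -
    have "0 < dist \<zeta> \<zeta>0 / 2" using that by simp
    then obtain J where J: "1 / Suc J < dist \<zeta> \<zeta>0 / 2" using nat_approx_posE by blast
    have "\<xi> \<notin> U j" if "j \<ge> J" "\<xi> \<in> ball \<zeta> (dist \<zeta> \<zeta>0 / 2)" for j \<xi>
    proof
      assume "\<xi> \<in> U j"
      then have "dist \<zeta>0 \<xi> < 1 / Suc j" using U(2)[of j] by auto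
      also have "\<dots> \<le> 1 / Suc J" using that(1) by (simp add: frac_le)
      finally show False
        using J that(2) dist_triangle[of \<zeta> \<zeta>0 \<xi>] by (simp add: dist_commute)
    qed
    then show ?thesis by blast
  qed
  have summable: "summable (\<lambda>j. p j * indicator (U j) \<zeta>)" for \<zeta>
  proof (cases "\<zeta> = \<zeta>0")
    case True
    then have "\<zeta> \<notin> U j" for j using U(2)[of j] by auto
    then show ?thesis by simp
  next
    case False
    then obtain J where "\<forall>j\<ge>J. \<zeta> \<notin> U j" using far[OF False] by force
    then show ?thesis by (intro summable_finite[of "{..<J}"]) (auto simp: not_less)
  qed
  have S_ge: "\<phi> 0 \<le> S \<zeta>" for \<zeta>
    unfolding S_def using suminf_nonneg[OF summable[of \<zeta>]] p(1) by simp
  have \<phi>u: "\<phi> (u \<zeta>) = S \<zeta>" for \<zeta>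
    unfolding u_def using \<psi>(3)[OF S_ge] .
  have S_nonneg: "0 \<le> S \<zeta>" for \<zeta> using S_ge[of \<zeta>] \<phi>_nonneg[of 0] by linarith
  have [measurable]: "S \<in> borel_measurable borel" unfolding S_def by measurable
  have S_fin: "(\<integral>\<^sup>+\<zeta>. ennreal (S \<zeta>) \<partial>circle_measure) < \<infinity>"
  proof -
    have "ennreal (S \<zeta>) = ennreal (\<phi> 0) + (\<Sum>j. ennreal (p j) * indicator (U j) \<zeta>)" for \<zeta>
    proof -
      have "ennreal (S \<zeta>) = ennreal (\<phi> 0) + ennreal (\<Sum>j. p j * indicator (U j) \<zeta>)"
        unfolding S_def using suminf_nonneg[OF summable[of \<zeta>]] p(1) \<phi>_nonneg by (intro ennreal_plus) auto
      also have "ennreal (\<Sum>j. p j * indicator (U j) \<zeta>) = (\<Sum>j. ennreal (p j * indicator (U j) \<zeta>))"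
        using summable p(1) by (intro suminf_ennreal2[symmetric]) auto
      also have "\<dots> = (\<Sum>j. ennreal (p j) * indicator (U j) \<zeta>)"
        by (intro suminf_cong) (auto split: split_indicator)
      finally show ?thesis .
    qed
    then have "(\<integral>\<^sup>+\<zeta>. ennreal (S \<zeta>) \<partial>circle_measure) = ennreal (\<phi> 0) + (\<Sum>j. ennreal (p j) * emeasure circle_measure (U j))"
      using circle.emeasure_space_1
      by (simp add: nn_integral_add nn_integral_suminf nn_integral_cmult_indicator)
    also have "(\<Sum>j. ennreal (p j) * emeasure circle_measure (U j)) = ennreal (\<Sum>j. p j * measure circle_measure (U j))"
      using p by (subst suminf_ennreal2[symmetric]) (auto simp: circle.emeasure_eq_measure ennreal_mult)
    finally show ?thesis by simp
  qed
  have u_nonneg: "0 \<le> u \<zeta>" for \<zeta> unfolding u_def by (rule \<psi>(2))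
  have "integrable circle_measure S"
    using S_fin S_nonneg by (intro integrableI_bounded) auto
  then have u_int: "integrable circle_measure u"
  proof (rule Bochner_Integration.integrable_bound[OF Bochner_Integration.integrable_add[OF circle.integrable_const[of T]]])
    show "AE \<zeta> in circle_measure. norm (u \<zeta>) \<le> norm (T + S \<zeta>)"
    proof (rule AE_I2)
      fix \<zeta>
      \<comment> \<open>Either \<open>u \<zeta> < T\<close>, or
        \<open>u \<zeta> \<le> \<phi> (u \<zeta>) = S \<zeta>\<close> by superlinear growth.\<close>
      have "u \<zeta> \<le> T + S \<zeta>"
        using T(1) T(2)[of "u \<zeta>"] S_nonneg[of \<zeta>] by (cases "T \<le> u \<zeta>") (auto simp: \<phi>u)
      then show "norm (u \<zeta>) \<le> norm (T + S \<zeta>)" using u_nonneg[of \<zeta>] by simp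
    qed
  qed (simp add: u_def)
  define f where "f = (\<lambda>z. exp (herglotz u z))"
  have "AE \<zeta> in circle_measure. norm \<zeta> = 1 \<and> \<zeta> \<noteq> \<zeta>0 \<and> (\<forall>j. \<zeta> \<notin> frontier (U j))"
  proof (intro AE_conjI AE_circle_measure_norm AE_all_countable[THEN iffD2] allI)
    show "AE \<zeta> in circle_measure. \<zeta> \<noteq> \<zeta>0"
      by (rule AE_I[of _ _ "{\<zeta>0}"]) (auto simp: circle.emeasure_eq_measure circle_measure_singleton)
    show "AE \<zeta> in circle_measure. \<zeta> \<notin> frontier (U j)" for j
      by (rule AE_I[of _ _ "frontier (U j)"]) (auto simp: circle.emeasure_eq_measure U)
  qed
  then have limit: "AE \<zeta> in circle_measure. norm \<zeta> = 1 \<and> (\<exists>M. has_nontangential_limit f \<zeta> M \<and> norm M = exp (u \<zeta>))"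
  proof eventually_elim
    fix \<zeta> assume \<zeta>: "norm \<zeta> = 1 \<and> \<zeta> \<noteq> \<zeta>0 \<and> (\<forall>j. \<zeta> \<notin> frontier (U j))"
    then obtain J where J: "\<And>j \<xi>. j \<ge> J \<Longrightarrow> \<xi> \<in> ball \<zeta> (dist \<zeta> \<zeta>0 / 2) \<Longrightarrow> \<xi> \<notin> U j"
      using far[of \<zeta>] by blast
    \<comment> \<open>The finitely many remaining indicators are locally constant off their
      frontiers, so \<open>u\<close> is constant near \<open>\<zeta>\<close>.\<close>
    have "eventually (\<lambda>\<xi>. \<forall>j\<in>{..<J}. indicator (U j) \<xi> = (indicator (U j) \<zeta> :: real)) (nhds \<zeta>)"
      using \<zeta> by (intro eventually_ball_finite ballI eventually_indicator_eq_off_frontier) auto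
    moreover have "eventually (\<lambda>\<xi>. \<xi> \<in> ball \<zeta> (dist \<zeta> \<zeta>0 / 2)) (nhds \<zeta>)"
      using \<zeta> by (intro eventually_nhds_in_open) auto
    ultimately have "eventually (\<lambda>\<xi>. u \<xi> = u \<zeta>) (nhds \<zeta>)"
    proof eventually_elim
      fix \<xi> assume 1: "\<forall>j\<in>{..<J}. indicator (U j) \<xi> = (indicator (U j) \<zeta> :: real)"
        and 2: "\<xi> \<in> ball \<zeta> (dist \<zeta> \<zeta>0 / 2)"
      have "indicator (U j) \<xi> = (indicator (U j) \<zeta> :: real)" for j
        using 1 J[of j \<xi>] J[of j \<zeta>] 2 \<zeta> by (cases "j < J") auto
      then show "u \<xi> = u \<zeta>" by (simp add: u_def S_def)
    qed
    then obtain d where d: "d > 0" "\<forall>\<xi>. dist \<xi> \<zeta> < d \<longrightarrow> u \<xi> = u \<zeta>"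
      unfolding eventually_nhds_metric by (elim exE conjE)
    have "\<exists>l. Re l = u \<zeta> \<and> (herglotz u \<longlongrightarrow> l) (at \<zeta> within ball 0 1)"
    proof (rule herglotz_limit_locally_const[OF u_int _ d(1)])
      show "u \<xi> = u \<zeta>" if "dist \<xi> \<zeta> < d" for \<xi>
        using d(2)[rule_format, OF that] .
    qed (use \<zeta> in simp)
    then obtain l where l: "Re l = u \<zeta>" "(herglotz u \<longlongrightarrow> l) (at \<zeta> within ball 0 1)"
      by blast
    have "has_nontangential_limit f \<zeta> (exp l)"
      unfolding f_def by (intro has_nontangential_limitI tendsto_intros l)
    then show "norm \<zeta> = 1 \<and> (\<exists>M. has_nontangential_limit f \<zeta> M \<and> norm M = exp (u \<zeta>))"
      using l(1) \<zeta> by (auto intro!: exI[of _ "exp l"])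
  qed
  show thesis
  proof
    have "AE \<zeta> in circle_measure. ennreal (comp_log \<phi> (norm (boundary_value f \<zeta>))) = ennreal (S \<zeta>)"
      using limit by eventually_elim (auto simp: boundary_value_eqI \<phi>u)
    then have "(\<integral>\<^sup>+\<zeta>. ennreal (comp_log \<phi> (norm (boundary_value f \<zeta>))) \<partial>circle_measure) =
        (\<integral>\<^sup>+\<zeta>. ennreal (S \<zeta>) \<partial>circle_measure)"
      by (rule nn_integral_cong_AE)
    then show "f \<in> Hardy_Orlicz (comp_log \<phi>)"
      using S_fin exp_herglotz_Smirnov[OF u_int u_nonneg] by (simp add: Hardy_Orlicz_def f_def)
    show "AE \<zeta> in circle_measure. \<exists>M. has_nontangential_limit f \<zeta> M \<and>
        (\<forall>j a. \<zeta> \<in> U j \<longrightarrow> \<phi> a \<le> p j \<longrightarrow> exp a \<le> norm M)"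
      using limit
    proof eventually_elim
      fix \<zeta> assume "norm \<zeta> = 1 \<and> (\<exists>M. has_nontangential_limit f \<zeta> M \<and> norm M = exp (u \<zeta>))"
      then obtain M where M: "has_nontangential_limit f \<zeta> M" "norm M = exp (u \<zeta>)" by blast
      have "a \<le> u \<zeta>" if "\<zeta> \<in> U j" "\<phi> a \<le> p j" for j a
      proof -
        have "p j = (\<Sum>i\<in>{j}. p i * indicator (U i) \<zeta>)" using that by simp
        also have "\<dots> \<le> (\<Sum>i. p i * indicator (U i) \<zeta>)"
          by (intro sum_le_suminf summable) (auto simp: p)
        also have "\<dots> \<le> S \<zeta>" using \<phi>_nonneg[of 0] by (simp add: S_def)
        finally have "\<phi> a \<le> \<phi> (u \<zeta>)" using that by (simp add: \<phi>u)
        then show ?thesis using strict_mono_less_eq[OF \<phi>(2)] by blast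
      qed
      then show "\<exists>M. has_nontangential_limit f \<zeta> M \<and> (\<forall>j a. \<zeta> \<in> U j \<longrightarrow> \<phi> a \<le> p j \<longrightarrow> exp a \<le> norm M)"
        using M by auto
    qed
  qed
qed

lemma Mult_power:
  assumes "g \<in> Mult X" "f \<in> X"
  shows "(\<lambda>z. g z ^ n * f z) \<in> X"
proof (induction n)
  case (Suc n)
  then have "(\<lambda>z. g z * (g z ^ n * f z)) \<in> X" using assms(1) by (simp add: Mult_def)
  then show ?case by (simp add: mult.assoc)
qed (use assms in simp)

text \<open>Testing a multiplier on the constant 1 shows that the multiplier itself is in the
  Smirnov class.\<close>

lemma one_in_Hardy_Orlicz: "(\<lambda>_. 1) \<in> Hardy_Orlicz (comp_log \<phi>)"
proof -
  have "(\<lambda>z. exp (herglotz (\<lambda>_. 0) z)) \<in> Smirnov"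
    by (intro exp_herglotz_Smirnov) auto
  then have "(\<lambda>_. 1) \<in> Smirnov" by (simp add: herglotz_def)
  moreover have "AE \<zeta> in circle_measure. ennreal (comp_log \<phi> (norm (boundary_value (\<lambda>_. 1) \<zeta>))) = ennreal (\<phi> 0)"
    using AE_circle_measure_norm
  proof eventually_elim
    fix \<zeta> :: complex assume "norm \<zeta> = 1"
    then have "boundary_value (\<lambda>_. 1) \<zeta> = 1"
      by (intro boundary_value_eqI has_nontangential_limitI) auto
    then show "ennreal (comp_log \<phi> (norm (boundary_value (\<lambda>_. 1) \<zeta>))) = ennreal (\<phi> 0)"
      using comp_log_exp[of \<phi> 0] by simp
  qed
  then have "(\<integral>\<^sup>+\<zeta>. ennreal (comp_log \<phi> (norm (boundary_value (\<lambda>_. 1) \<zeta>))) \<partial>circle_measure) < \<infinity>"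
    using circle.emeasure_space_1 by (subst nn_integral_cong_AE) auto
  ultimately show ?thesis by (simp add: Hardy_Orlicz_def)
qed

section \<open>Multipliers\<close>

lemma Mult_Hardy_Orlicz_Psi_integral:
  assumes \<phi>: "strongly_convex \<phi>" "strict_mono \<phi>" and \<gamma>: "nabla_admissible \<phi> \<gamma>"
    and g: "g \<in> Mult (Hardy_Orlicz (comp_log \<phi>))" and n: "n \<ge> 1"
  shows "(\<integral>\<^sup>+\<zeta>. ennreal (Psi \<phi> \<gamma> n (norm (boundary_value g \<zeta>))) \<partial>circle_measure) < \<infinity>"
proof (rule ccontr)
  define F where "F = (\<lambda>\<zeta>. ennreal (Psi \<phi> \<gamma> n (norm (boundary_value g \<zeta>))))"
  assume "\<not> ?thesis"
  then have "(\<integral>\<^sup>+\<zeta>. F \<zeta> \<partial>circle_measure) = \<infinity>"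
    by (simp add: F_def flip: less_top)
  \<comment> \<open>The minorant has Borel level sets, and these are contained in the level sets of
    \<open>F\<close>.\<close>
  then obtain h where h: "h \<in> borel_measurable circle_measure" "h \<le> F" "(\<integral>\<^sup>+\<zeta>. h \<zeta> \<partial>circle_measure) = \<infinity>"
    using nn_integral_measurable_minorant[of circle_measure F] by auto
  have h_meas: "h \<in> borel_measurable borel" using h(1) by (simp cong: measurable_cong_sets)
  have h_fin: "h \<zeta> < top" for \<zeta>
    using h(2) by (auto simp: le_fun_def F_def intro: le_less_trans)
  obtain \<zeta>0 where \<zeta>0: "\<And>W. open W \<Longrightarrow> \<zeta>0 \<in> W \<Longrightarrow> (\<integral>\<^sup>+\<zeta>. h \<zeta> * indicator (W - {\<zeta>0}) \<zeta> \<partial>circle_measure) = \<infinity>"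
    using circle_measure_infinite_point[OF h_meas h(3)] by blast
  obtain \<epsilon> s0 where \<epsilon>: "\<epsilon> > 0" "s0 > 0" "\<And>s. s \<ge> s0 \<Longrightarrow> \<phi> (s + \<gamma> s) / \<phi> s \<ge> ln (\<phi> s) powr (1 + \<epsilon>)"
    using \<gamma> unfolding nabla_admissible_def by blast
  \<comment> \<open>The value of \<open>Psi\<close> at points where \<open>g\<close> has no
    non-tangential limit; levels above \<open>C\<close> force a genuine limit.\<close>
  define C where "C = Psi \<phi> \<gamma> n (norm (THE L::complex. False))"
  \<comment> \<open>The exponent of \<open>c\<close> exceeds 1, making \<open>1 / c k\<close>
    summable, yet stays below the exponent of \<open>D\<close>, making \<open>D k / c k\<close>
    unbounded. \<open>D k\<close> is the admissibility bound at level \<open>2 ^ k\<close>, where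
    \<open>ln (2 ^ k) = k * ln 2\<close>.\<close>
  define c where "c = (\<lambda>k::nat. real (Suc k) powr (1 + \<epsilon> / 2))"
  define D where "D = (\<lambda>k::nat. (real k * ln 2) powr (1 + \<epsilon>))"
  have c_pos: "c k > 0" for k by (simp add: c_def)
  have c_summable: "summable (\<lambda>k. 1 / c k)"
  proof -
    have "summable (\<lambda>k. real k powr (- (1 + \<epsilon> / 2)))"
      using \<epsilon>(1) by (subst summable_real_powr_iff) auto
    then have "summable (\<lambda>k. real (Suc k) powr (- (1 + \<epsilon> / 2)))"
      by (subst summable_Suc_iff)
    then show ?thesis by (simp only: c_def powr_minus_divide)
  qed
  \<comment> \<open>The first demand makes the \<open>j\<close>-th hump contribute at least
    \<open>j\<close>, the second gives a geometric majorant for the series defining the test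
    function, and the third puts the level above \<open>C\<close>, into the range of the inverse of
    \<open>\<phi>\<close>, and beyond the threshold \<open>s0\<close>.\<close>
  have "eventually (\<lambda>k. real j \<le> D k / c k \<and> 4 * 2 ^ j \<le> c k \<and> max C (max (\<phi> 0) (\<phi> s0)) < 2 ^ k) sequentially" for j
  proof (intro eventually_conj)
    have "filterlim (\<lambda>k. D k / c k) at_top sequentially"
      unfolding D_def c_def using \<epsilon>(1) by real_asymp
    then show "eventually (\<lambda>k. real j \<le> D k / c k) sequentially" by (simp add: filterlim_at_top)
    have "filterlim c at_top sequentially"
      unfolding c_def using \<epsilon>(1) by real_asymp
    then show "eventually (\<lambda>k. 4 * 2 ^ j \<le> c k) sequentially" by (simp add: filterlim_at_top)
    have "filterlim (\<lambda>k::nat. 2 ^ k :: real) at_top sequentially" by real_asymp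
    then show "eventually (\<lambda>k. max C (max (\<phi> 0) (\<phi> s0)) < 2 ^ k) sequentially"
      unfolding filterlim_at_top_dense by blast
  qed
  then have "\<exists>K. \<forall>k\<ge>K. real j \<le> D k / c k \<and> 4 * 2 ^ j \<le> c k \<and> max C (max (\<phi> 0) (\<phi> s0)) < 2 ^ k" for j
    by (simp add: eventually_sequentially)
  then obtain K where K: "\<And>j k. k \<ge> K j \<Longrightarrow> real j \<le> D k / c k"
      "\<And>j k. k \<ge> K j \<Longrightarrow> 4 * 2 ^ j \<le> c k"
      "\<And>j k. k \<ge> K j \<Longrightarrow> max C (max (\<phi> 0) (\<phi> s0)) < 2 ^ k"
    by metis
  have "\<exists>k A U. k \<ge> K j \<and> A \<in> sets borel \<and> A \<subseteq> U \<and> open U \<and> U \<subseteq> ball \<zeta>0 (1 / Suc j) - {\<zeta>0} \<and>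
      measure circle_measure (frontier U) = 0 \<and> (\<forall>\<zeta>\<in>A. ennreal (2 ^ k) \<le> h \<zeta>) \<and>
      1 \<le> 2 ^ k * c k * measure circle_measure A \<and> 2 ^ k * c k * measure circle_measure U \<le> 4" for j
  proof -
    let ?W = "ball \<zeta>0 (1 / Suc j) - {\<zeta>0}"
    have "open ?W" by (intro open_Diff) auto
    moreover have "(\<integral>\<^sup>+\<zeta>. h \<zeta> * indicator ?W \<zeta> \<partial>circle_measure) = \<infinity>"
      by (intro \<zeta>0) auto
    ultimately obtain k A U where "k \<ge> K j" "A \<in> sets borel" "A \<subseteq> U" "open U" "U \<subseteq> ?W"
      "measure circle_measure (frontier U) = 0" "\<And>\<zeta>. \<zeta> \<in> A \<Longrightarrow> ennreal (2 ^ k) \<le> h \<zeta>"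
      "1 \<le> 2 ^ k * c k * measure circle_measure A" "2 ^ k * c k * measure circle_measure U \<le> 4"
      using circle_measure_hump[OF h_meas h_fin _ _ c_pos c_summable, of ?W "K j"] by blast
    then show ?thesis by blast
  qed
  then obtain k A U where kAU: "\<And>j. k j \<ge> K j" "\<And>j. A j \<in> sets borel" "\<And>j. A j \<subseteq> U j" "\<And>j. open (U j)"
      "\<And>j. U j \<subseteq> ball \<zeta>0 (1 / Suc j) - {\<zeta>0}" "\<And>j. measure circle_measure (frontier (U j)) = 0"
      "\<And>j \<zeta>. \<zeta> \<in> A j \<Longrightarrow> ennreal (2 ^ k j) \<le> h \<zeta>"
      "\<And>j. 1 \<le> 2 ^ k j * c (k j) * measure circle_measure (A j)"
      "\<And>j. 2 ^ k j * c (k j) * measure circle_measure (U j) \<le> 4"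
    by metis
  note K' = K[OF kAU(1)]
  have "summable (\<lambda>j. 2 ^ k j * measure circle_measure (U j))"
  proof (rule summable_comparison_test')
    show "summable (\<lambda>j. (1/2::real) ^ j)" by (rule summable_geometric) simp
    fix j
    have "4 * 2 ^ j * (2 ^ k j * measure circle_measure (U j)) \<le> c (k j) * (2 ^ k j * measure circle_measure (U j))"
      by (intro mult_right_mono K') simp
    also have "\<dots> \<le> 4" using kAU(9)[of j] by (simp add: mult_ac)
    finally show "norm (2 ^ k j * measure circle_measure (U j)) \<le> (1/2) ^ j"
      by (simp add: field_simps)
  qed
  then obtain f where f: "f \<in> Hardy_Orlicz (comp_log \<phi>)"
    "AE \<zeta> in circle_measure. \<exists>M. has_nontangential_limit f \<zeta> M \<and> (\<forall>j a. \<zeta> \<in> U j \<longrightarrow> \<phi> a \<le> 2 ^ k j \<longrightarrow> exp a \<le> norm M)"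
    using Hardy_Orlicz_test_function[OF \<phi> kAU(4-6), of "\<lambda>j. 2 ^ k j"] by auto
  obtain \<psi> where \<psi>: "mono \<psi>" "\<And>y. 0 \<le> \<psi> y" "\<And>y. \<phi> 0 \<le> y \<Longrightarrow> \<phi> (\<psi> y) = y"
    using strongly_convex_right_inverse[OF \<phi>] by blast
  let ?G = "\<lambda>z. g z ^ n * f z"
  have G: "(\<integral>\<^sup>+\<zeta>. ennreal (comp_log \<phi> (norm (boundary_value ?G \<zeta>))) \<partial>circle_measure) < \<infinity>"
    using Mult_power[OF g f(1), of n] by (simp add: Hardy_Orlicz_def)
  have big: "comp_log \<phi> (norm (boundary_value ?G \<zeta>)) \<ge> 2 ^ k j * D (k j)"
    if \<zeta>: "norm \<zeta> = 1" "\<zeta> \<in> A j" and M: "has_nontangential_limit f \<zeta> M"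
      "\<And>j a. \<zeta> \<in> U j \<Longrightarrow> \<phi> a \<le> 2 ^ k j \<Longrightarrow> exp a \<le> norm M" for j \<zeta> M
  proof -
    \<comment> \<open>The height with \<open>\<phi> a = 2 ^ k j\<close>, so that
      \<open>exp a\<close> bounds the modulus of \<open>f\<close> from below on
      \<open>A j\<close>.\<close>
    define a where "a = \<psi> (2 ^ k j)"
    have \<phi>a: "\<phi> a = 2 ^ k j" unfolding a_def using K'(3)[of j] by (intro \<psi>(3)) simp
    have a: "s0 < a" using K'(3)[of j] strict_mono_less[OF \<phi>(2)] by (simp flip: \<phi>a)
    have "ennreal (2 ^ k j) \<le> F \<zeta>"
      using kAU(7)[OF \<zeta>(2)] h(2) by (auto simp: le_fun_def intro: order_trans)
    moreover have Psi_nonneg: "0 \<le> Psi \<phi> \<gamma> n t" for t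
      using \<phi>(1) by (simp add: Psi_def strongly_convex_def)
    ultimately have F_ge: "2 ^ k j \<le> Psi \<phi> \<gamma> n (norm (boundary_value g \<zeta>))"
      by (simp add: F_def)
    have "\<exists>L. has_nontangential_limit g \<zeta> L"
    proof (rule ccontr)
      assume "\<not> ?thesis"
      then have "2 ^ k j \<le> C" using F_ge by (simp add: boundary_value_junk C_def)
      then show False using K'(3)[of j] by simp
    qed
    then obtain L where L: "has_nontangential_limit g \<zeta> L" by blast
    define V where "V = gamma_inverse \<gamma> (ereal (real n) * log_ext (norm L))"
    have "\<phi> a \<le> \<phi> V"
      using F_ge boundary_value_eqI[OF \<zeta>(1) L] by (simp add: Psi_def V_def \<phi>a)
    then have aV: "a \<le> V" using strict_mono_less_eq[OF \<phi>(2)] by blast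
    \<comment> \<open>Since \<open>V \<ge> a > s0 > 0\<close>, the default branch of
      \<open>gamma_inverse\<close> is excluded.\<close>
    then have V: "0 < norm L" "0 < V" "\<gamma> V = real n * ln (norm L)"
      using gamma_inverse_eq[OF \<gamma> n, of "norm L"] a \<epsilon>(2) unfolding V_def[symmetric] by auto
    have "\<gamma> a \<le> \<gamma> V"
      using \<gamma> aV a \<epsilon>(2) strict_mono_on_leD[of "{0<..}" \<gamma> a V] by (auto simp: nabla_admissible_def)
    \<comment> \<open>The factor \<open>n\<close> inside \<open>Psi\<close> becomes the
      \<open>n\<close>-th power of the multiplier.\<close>
    moreover have "exp (\<gamma> V) = norm L ^ n"
      using V(1) unfolding V(3) exp_of_nat_mult by simp
    ultimately have "exp (\<gamma> a) \<le> norm L ^ n" by (metis exp_le_cancel_iff)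
    moreover have "exp a \<le> norm M" using kAU(3) \<zeta>(2) \<phi>a by (intro M(2)[of j]) auto
    ultimately have "exp (\<gamma> a) * exp a \<le> norm (L ^ n * M)"
      unfolding norm_mult norm_power by (intro mult_mono) auto
    then have le: "exp (a + \<gamma> a) \<le> norm (L ^ n * M)" by (simp add: exp_add mult.commute)
    moreover from this have pos: "0 < norm (L ^ n * M)" by (rule less_le_trans[OF exp_gt_zero])
    ultimately have "a + \<gamma> a \<le> ln (norm (L ^ n * M))" by (simp add: ln_ge_iff)
    then have "\<phi> (a + \<gamma> a) \<le> comp_log \<phi> (norm (L ^ n * M))"
      using pos strict_mono_less_eq[OF \<phi>(2)] comp_log_exp[of \<phi> "ln (norm (L ^ n * M))"] by simp
    moreover have "boundary_value ?G \<zeta> = L ^ n * M"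
      by (intro boundary_value_eqI \<zeta> has_nontangential_limit_power_mult L M)
    \<comment> \<open>Admissibility at \<open>a\<close>, with the denominator
      \<open>\<phi> a = 2 ^ k j\<close> cleared.\<close>
    moreover have "2 ^ k j * D (k j) \<le> \<phi> (a + \<gamma> a)"
      using \<epsilon>(3)[of a] a by (simp add: \<phi>a ln_realpow D_def field_simps)
    ultimately show ?thesis by simp
  qed
  have lower: "of_nat j \<le> (\<integral>\<^sup>+\<zeta>. ennreal (comp_log \<phi> (norm (boundary_value ?G \<zeta>))) \<partial>circle_measure)" for j
  proof -
    \<comment> \<open>As \<open>A j\<close> has mass at least
      \<open>1 / (2 ^ k j * c (k j))\<close>, the level \<open>2 ^ k j * D (k j)\<close> on it
      contributes at least \<open>D (k j) / c (k j)\<close>.\<close>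
    have "real j \<le> D (k j) / c (k j)" by (rule K')
    also have "\<dots> \<le> D (k j) / c (k j) * (2 ^ k j * c (k j) * measure circle_measure (A j))"
      using mult_left_mono[OF kAU(8)[of j], of "D (k j) / c (k j)"] c_pos[of "k j"] by (simp add: D_def)
    also have "\<dots> = 2 ^ k j * D (k j) * measure circle_measure (A j)"
      using c_pos[of "k j"] by (simp add: field_simps)
    finally have "of_nat j \<le> ennreal (2 ^ k j * D (k j) * measure circle_measure (A j))"
      unfolding ennreal_of_nat_eq_real_of_nat by (rule ennreal_leI)
    also have "\<dots> = (\<integral>\<^sup>+\<zeta>. ennreal (2 ^ k j * D (k j)) * indicator (A j) \<zeta> \<partial>circle_measure)"
      using kAU(2)[of j] by (subst nn_integral_cmult_indicator)
        (auto simp: circle.emeasure_eq_measure ennreal_mult' D_def)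
    also have "\<dots> \<le> (\<integral>\<^sup>+\<zeta>. ennreal (comp_log \<phi> (norm (boundary_value ?G \<zeta>))) \<partial>circle_measure)"
    proof (rule nn_integral_mono_AE)
      show "AE \<zeta> in circle_measure. ennreal (2 ^ k j * D (k j)) * indicator (A j) \<zeta>
          \<le> ennreal (comp_log \<phi> (norm (boundary_value ?G \<zeta>)))"
        using f(2) AE_circle_measure_norm
        by eventually_elim (auto split: split_indicator intro!: ennreal_leI big)
    qed
    finally show ?thesis .
  qed
  obtain m where m: "(\<integral>\<^sup>+\<zeta>. ennreal (comp_log \<phi> (norm (boundary_value ?G \<zeta>))) \<partial>circle_measure) < of_nat m"
    using ennreal_Ex_less_of_nat[OF G[unfolded infinity_ennreal_def]] by (elim exE)
  show False
    by (rule notE[OF leD[OF lower] m])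
qed

theorem theorem3p4:
  fixes \<phi> \<gamma> :: "real \<Rightarrow> real"
  assumes "strongly_convex \<phi>"
    and "nabla_condition \<phi>"
    and "nabla_admissible \<phi> \<gamma>"
  shows "Mult (Hardy_Orlicz (comp_log \<phi>)) \<subseteq> (\<Inter>n\<in>{1..}. Hardy_Orlicz (Psi \<phi> \<gamma> n))"
proof (intro subsetI INT_I)
  fix g n assume g: "g \<in> Mult (Hardy_Orlicz (comp_log \<phi>))" and "n \<in> {1::nat..}"
  then have n: "n \<ge> 1" by simp
  \<comment> \<open>The exponent 1 and the test function 1 recover \<open>g\<close> itself.\<close>
  have "(\<lambda>z. g z ^ 1 * 1) \<in> Hardy_Orlicz (comp_log \<phi>)"
    by (rule Mult_power[OF g one_in_Hardy_Orlicz])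
  then have "g \<in> Smirnov" by (simp add: Hardy_Orlicz_def)
  moreover have "strict_mono \<phi>" using assms(2) by (simp add: nabla_condition_def)
  ultimately show "g \<in> Hardy_Orlicz (Psi \<phi> \<gamma> n)"
    using Mult_Hardy_Orlicz_Psi_integral[OF assms(1) _ assms(3) g n] by (simp add: Hardy_Orlicz_def)
qed

end
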